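(* Let $K$ be a field, let $x_1,\dots,x_n\in K$ and $z_1,\dots,z_n\in K^\times$, and let $S_1,\dots,S_n\subseteq \mathrm{S}_{\mathrm{ord}}(K)$ be pairwise disjoint sets of orderings on $K$. Assume: (T) each $S_i$ is compact in the Harrison topology on $\mathrm{S}_{\mathrm{ord}}(K)$; (I) if $w$ is a valuation on $K$ whose valuation ring $\mathcal{O}_w$ is convex both with respect to an ordering in $S_i$ and with respect to an ordering in $S_j$, $i\neq j$, then these two orderings induce distinct orderings on the residue field of $w$, and $w(x_i-x_j)\geq w(z_i)=w(z_j)$. Then there exists $x\in K$ with $$(x-x_i)^2<z_i^2\quad\text{for all orderings in } S_i,\ \text{for } i=1,\dots,n.$$
   Context: $\mathrm{S}_{\mathrm{ord}}(K)$ is the set of field orderings of $K$. The Harrison topology on it has as subbasis of open sets the sets of orderings $\{v\in \mathrm{S}_{\mathrm{ord}}(K): x\geq_v 0\}$, $x\in K$, where $\leq_v$ is the order relation of $v$. "Valuation" means Krull valuation, written additively; the trivial valuation is allowed. If $\mathcal{O}_w$ is convex with respect to an ordering $\leq$ of $K$, then $\leq$ induces an ordering on the residue field $Kw$, in which the nonnegative elements are the residues of the nonnegative elements of $\mathcal{O}_w$. *)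

theory Defs
  imports
    "HOL-Analysis.Function_Topology"
    "HOL-Algebra.QuotRing"
    "HOL-Library.Disjoint_Sets"
begin

definition field_ordering :: "'a::field rel \<Rightarrow> bool" where
  "field_ordering r \<longleftrightarrow>
     linear_order r \<and>
     (\<forall>x y z. (x, y) \<in> r \<longrightarrow> (x + z, y + z) \<in> r) \<and>
     (\<forall>x y. (0, x) \<in> r \<longrightarrow> (0, y) \<in> r \<longrightarrow> (0, x * y) \<in> r)"

definition field_orderings :: "'a::field rel set" where
  "field_orderings = {r. field_ordering r}"

definition harrison_topology :: "'a::field rel topology" where
  "harrison_topology =
     topology_generated_by (range (\<lambda>x::'a. {r \<in> field_orderings. (0, x) \<in> r}))"

definition convex_wrt :: "'a rel \<Rightarrow> 'a set \<Rightarrow> bool" where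
  "convex_wrt r A \<longleftrightarrow> (\<forall>a\<in>A. \<forall>b\<in>A. \<forall>x. (a, x) \<in> r \<longrightarrow> (x, b) \<in> r \<longrightarrow> x \<in> A)"

(* The group operation is written multiplicatively, as in HOL-Algebra, so the neutral
   element \<one> plays the role of the value 0 of an additively written valuation. *)
record 'g ordered_group = "'g monoid" +
  ord_rel :: "'g rel"

locale ordered_abelian_group = comm_group G for G :: "'g ordered_group" +
  assumes ord_linear: "linear_order_on (carrier G) (ord_rel G)"
    and ord_mono: "(a, b) \<in> ord_rel G \<Longrightarrow> c \<in> carrier G \<Longrightarrow>
      (a \<otimes>\<^bsub>G\<^esub> c, b \<otimes>\<^bsub>G\<^esub> c) \<in> ord_rel G"

(* The value group with infinity adjoined: None is infinity. *)
definition val_le :: "'g ordered_group \<Rightarrow> 'g option \<Rightarrow> 'g option \<Rightarrow> bool" where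
  "val_le G a b \<longleftrightarrow> b = None \<or> (\<exists>g h. a = Some g \<and> b = Some h \<and> (g, h) \<in> ord_rel G)"

fun val_add :: "'g ordered_group \<Rightarrow> 'g option \<Rightarrow> 'g option \<Rightarrow> 'g option" where
  "val_add G (Some g) (Some h) = Some (g \<otimes>\<^bsub>G\<^esub> h)"
| "val_add G _ _ = None"

(* The third axiom is w (x + y) \<ge> min (w x) (w y). *)
definition krull_valuation :: "'g ordered_group \<Rightarrow> ('a::field \<Rightarrow> 'g option) \<Rightarrow> bool" where
  "krull_valuation G w \<longleftrightarrow>
     ordered_abelian_group G \<and>
     (\<forall>x. if x = 0 then w x = None else w x \<in> Some ` carrier G) \<and>
     (\<forall>x y. w (x * y) = val_add G (w x) (w y)) \<and>
     (\<forall>x y. val_le G (w x) (w (x + y)) \<or> val_le G (w y) (w (x + y)))"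

definition valuation_ring :: "'g ordered_group \<Rightarrow> ('a::field \<Rightarrow> 'g option) \<Rightarrow> 'a set" where
  "valuation_ring G w = {x. val_le G (Some \<one>\<^bsub>G\<^esub>) (w x)}"

definition valuation_ideal :: "'g ordered_group \<Rightarrow> ('a::field \<Rightarrow> 'g option) \<Rightarrow> 'a set" where
  "valuation_ideal G w = {x \<in> valuation_ring G w. w x \<noteq> Some \<one>\<^bsub>G\<^esub>}"

definition valuation_ring_struct :: "'g ordered_group \<Rightarrow> ('a::field \<Rightarrow> 'g option) \<Rightarrow> 'a ring" where
  "valuation_ring_struct G w =
     \<lparr>carrier = valuation_ring G w, mult = (*), one = 1, zero = 0, add = (+)\<rparr>"

definition residue_field :: "'g ordered_group \<Rightarrow> ('a::field \<Rightarrow> 'g option) \<Rightarrow> 'a set ring" where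
  "residue_field G w = valuation_ring_struct G w Quot valuation_ideal G w"

definition residue :: "'g ordered_group \<Rightarrow> ('a::field \<Rightarrow> 'g option) \<Rightarrow> 'a \<Rightarrow> 'a set" where
  "residue G w a = valuation_ideal G w +>\<^bsub>valuation_ring_struct G w\<^esub> a"

definition induced_ordering ::
  "'g ordered_group \<Rightarrow> ('a::field \<Rightarrow> 'g option) \<Rightarrow> 'a rel \<Rightarrow> 'a set rel" where
  "induced_ordering G w r =
     {(A, B). A \<in> carrier (residue_field G w) \<and> B \<in> carrier (residue_field G w) \<and>
        B \<ominus>\<^bsub>residue_field G w\<^esub> A \<in> residue G w ` {a \<in> valuation_ring G w. (0, a) \<in> r}}"

(* A hypothesis on all valuations of K = 'a cannot range over all types of values. It suffices
   to consider value groups on subsets of the type 'a set: up to equivalence the value group is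
   K\<^sup>\<times> modulo the units of the valuation ring, whose elements are subsets of K.
   The next lemma makes this precise. *)
lemma krull_valuation_equiv_set_valued:
  fixes G :: "'g ordered_group" and w :: "'a::field \<Rightarrow> 'g option"
  assumes "krull_valuation G w"
  shows "\<exists>(G' :: 'a set ordered_group) w'. krull_valuation G' w' \<and>
    (\<forall>x y. val_le G' (w' x) (w' y) \<longleftrightarrow> val_le G (w x) (w y)) \<and>
    valuation_ring G' w' = valuation_ring G w \<and> valuation_ideal G' w' = valuation_ideal G w"
proof -
  have G: "ordered_abelian_group G"
    and w0: "w 0 = None"
    and wS: "\<And>x. x \<noteq> 0 \<Longrightarrow> w x \<in> Some ` carrier G"
    and wmult: "\<And>x y. w (x * y) = val_add G (w x) (w y)"
    and wadd: "\<And>x y. val_le G (w x) (w (x + y)) \<or> val_le G (w y) (w (x + y))"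
    using assms unfolding krull_valuation_def by (auto split: if_splits)
  interpret ordered_abelian_group G by (rule G)
  define v where "v x = the (w x)" for x
  define H where "H = v ` (UNIV - {0})"
  define \<phi> where "\<phi> g = {x. w x = Some g}" for g
  define \<psi> where "\<psi> A = v (SOME x. x \<in> A)" for A
  have wv: "w x = Some (v x)" "v x \<in> carrier G" if "x \<noteq> 0" for x
    using wS[OF that] by (auto simp: v_def)
  have Hc: "H \<subseteq> carrier G" using wv by (auto simp: H_def)
  have psi: "\<psi> (\<phi> g) = g" if gH: "g \<in> H" for g
  proof -
    obtain x where "x \<noteq> 0" "g = v x" using gH by (auto simp: H_def)
    then have "x \<in> \<phi> g" using wv by (auto simp: \<phi>_def)
    then have "(SOME x. x \<in> \<phi> g) \<in> \<phi> g" by (rule someI)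
    then show ?thesis by (auto simp: \<psi>_def \<phi>_def v_def)
  qed
  have vmult: "v (x * y) = v x \<otimes>\<^bsub>G\<^esub> v y" if "x \<noteq> 0" "y \<noteq> 0" for x y
    using wmult[of x y] wv(1)[OF that(1)] wv(1)[OF that(2)] wv(1)[of "x * y"] that by simp
  have v1: "v 1 = \<one>\<^bsub>G\<^esub>"
    using vmult[of 1 1] wv(2)[of 1] by (simp add: l_cancel_one)
  have H1: "\<one>\<^bsub>G\<^esub> \<in> H"
    unfolding H_def using v1 by (intro image_eqI[of _ _ 1]) auto
  have Hm: "g \<otimes>\<^bsub>G\<^esub> h \<in> H" if gh: "g \<in> H" "h \<in> H" for g h
  proof -
    obtain x y where "x \<noteq> 0" "y \<noteq> 0" "g = v x" "h = v y" using gh by (auto simp: H_def)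
    then show ?thesis unfolding H_def by (intro image_eqI[of _ _ "x * y"]) (auto simp: vmult)
  qed
  have Hi: "\<exists>h\<in>H. h \<otimes>\<^bsub>G\<^esub> g = \<one>\<^bsub>G\<^esub>" if gH: "g \<in> H" for g
  proof -
    obtain x where x: "x \<noteq> 0" "g = v x" using gH by (auto simp: H_def)
    have "v (inverse x) \<otimes>\<^bsub>G\<^esub> v x = \<one>\<^bsub>G\<^esub>" using x vmult[of "inverse x" x] v1 by simp
    then show ?thesis using x unfolding H_def by (intro bexI[of _ "v (inverse x)"]) auto
  qed
  define G' :: "'a set ordered_group" where
    "G' = \<lparr>carrier = \<phi> ` H, mult = (\<lambda>A B. \<phi> (\<psi> A \<otimes>\<^bsub>G\<^esub> \<psi> B)), one = \<phi> \<one>\<^bsub>G\<^esub>,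
       ord_rel = {(A, B). A \<in> \<phi> ` H \<and> B \<in> \<phi> ` H \<and> (\<psi> A, \<psi> B) \<in> ord_rel G}\<rparr>"
  define w' where "w' x = (if x = 0 then None else Some (\<phi> (v x)))" for x
  have lin: "refl_on (carrier G) (ord_rel G)" "trans (ord_rel G)" "antisym (ord_rel G)"
    "total_on (carrier G) (ord_rel G)"
    using ord_linear by (auto simp: linear_order_on_def partial_order_on_def preorder_on_def)
  have "comm_group G'"
  proof (rule comm_groupI)
    show "\<exists>y\<in>carrier G'. y \<otimes>\<^bsub>G'\<^esub> x = \<one>\<^bsub>G'\<^esub>" if "x \<in> carrier G'" for x
    proof -
      obtain g where g: "g \<in> H" "x = \<phi> g" using \<open>x \<in> carrier G'\<close> by (auto simp: G'_def)
      obtain h where "h \<in> H" "h \<otimes>\<^bsub>G\<^esub> g = \<one>\<^bsub>G\<^esub>" using Hi[OF g(1)] by blast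
      then show ?thesis using g by (intro bexI[of _ "\<phi> h"]) (auto simp: G'_def psi)
    qed
  qed (use Hc in \<open>auto simp: G'_def psi Hm H1 subset_iff intro!: arg_cong[of _ _ \<phi>] m_assoc m_comm\<close>)
  moreover have "linear_order_on (carrier G') (ord_rel G')"
    unfolding linear_order_on_def partial_order_on_def preorder_on_def
  proof (intro conjI)
    show "refl_on (carrier G') (ord_rel G')"
      using lin(1) Hc by (auto simp: refl_on_def G'_def psi)
    show "trans (ord_rel G')"
      using lin(2) by (auto simp: trans_def G'_def psi)
    show "antisym (ord_rel G')"
      using antisymD[OF lin(3)] by (intro antisymI) (force simp: G'_def psi)
    show "total_on (carrier G') (ord_rel G')"
    proof (rule total_onI)
      fix A B assume "A \<in> carrier G'" "B \<in> carrier G'" "A \<noteq> B"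
      then obtain g h where gh: "g \<in> H" "h \<in> H" "A = \<phi> g" "B = \<phi> h" "g \<noteq> h"
        by (auto simp: G'_def)
      then have "(g, h) \<in> ord_rel G \<or> (h, g) \<in> ord_rel G"
        using lin(4) Hc unfolding total_on_def by blast
      then show "(A, B) \<in> ord_rel G' \<or> (B, A) \<in> ord_rel G'"
        using gh by (auto simp: G'_def psi)
    qed
  qed (auto simp: G'_def)
  ultimately have G': "ordered_abelian_group G'"
    using ord_mono Hc
    by (auto simp: ordered_abelian_group_def ordered_abelian_group_axioms_def G'_def psi Hm subset_iff)
  have vH: "v x \<in> H" if "x \<noteq> 0" for x using that by (auto simp: H_def)
  have le: "val_le G' (w' x) (w' y) \<longleftrightarrow> val_le G (w x) (w y)" for x y
    using vH w0 wv(1) by (cases "x = 0"; cases "y = 0") (auto simp: val_le_def w'_def G'_def psi)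
  have w'1: "w' 1 = Some \<one>\<^bsub>G'\<^esub>" and w1: "w 1 = Some \<one>\<^bsub>G\<^esub>"
    using v1 wv(1)[of 1] by (auto simp: w'_def G'_def)
  have one: "w' x = Some \<one>\<^bsub>G'\<^esub> \<longleftrightarrow> w x = Some \<one>\<^bsub>G\<^esub>" for x
  proof (cases "x = 0")
    case False
    have "\<phi> (v x) = \<phi> \<one>\<^bsub>G\<^esub> \<longleftrightarrow> v x = \<one>\<^bsub>G\<^esub>"
      using psi[OF vH[OF False]] psi[OF H1] by metis
    then show ?thesis using False wv(1)[OF False] by (simp add: w'_def G'_def)
  qed (simp add: w'_def w0)
  have K: "krull_valuation G' w'"
    unfolding krull_valuation_def
  proof (intro conjI allI)
    show "if x = 0 then w' x = None else w' x \<in> Some ` carrier G'" for x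
      using vH by (auto simp: w'_def G'_def)
    show "w' (x * y) = val_add G' (w' x) (w' y)" for x y
      using vH by (auto simp: w'_def G'_def psi vmult)
    show "val_le G' (w' x) (w' (x + y)) \<or> val_le G' (w' y) (w' (x + y))" for x y
      using wadd le by blast
  qed (rule G')
  have O: "valuation_ring G' w' = valuation_ring G w"
    using le[of 1] by (auto simp: valuation_ring_def w'1 w1)
  have "valuation_ideal G' w' = valuation_ideal G w"
    by (auto simp: valuation_ideal_def O one)
  with K le O show ?thesis by blast
qed

end

theory Submission
  imports Defs
begin

text \<open>
  Call \<open>h\<close> separating for two orderings \<open>r\<close>, \<open>s\<close> if \<open>h\<close> is large for \<open>r\<close> and \<open>1/h\<close> is large for \<open>s\<close>.
  The elements \<open>a\<close> with \<open>a\<^sup>2 \<le> h\<close> for \<open>r\<close> and \<open>a\<^sup>2 \<le> 1/h\<close> for \<open>s\<close>, for some separating \<open>h\<close>, form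
  a ring that is convex for both orderings as soon as one separating element exists; and if none
  exists, then the elements that are finite for both orderings form such a ring, in which a
  unit of different signs would yield a separating element after all. Hypothesis (I), applied to the
  valuations of these two rings, therefore shows for \<open>r \<in> S i\<close> and \<open>s \<in> S j\<close> that separating
  elements exist, even relative to the bound \<open>((x i - x j) / z j)\<^sup>2\<close>. Since \<open>(h, k) \<mapsto> h\<^sup>2 + k\<^sup>2\<close> keeps
  elements below \<open>1/c\<close> small and keeps one element above \<open>c\<close> large, compactness yields totally positive
  elements that separate \<open>S i\<close> from \<open>S j\<close>. From them one forms totally positive weights \<open>h i\<close> with
  \<open>h j\<close> dominant on \<open>S j\<close>, and the weighted average of the \<open>x i\<close> is the required element.
\<close>

section \<open>Arithmetic in an ordered field\<close>

text \<open>Curried predicates are introduced because the class locale for ordered fields expects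
  its order in this form.\<close>

definition ord_le :: "'a rel \<Rightarrow> 'a \<Rightarrow> 'a \<Rightarrow> bool" where
  "ord_le r a b \<longleftrightarrow> (a, b) \<in> r"

definition ord_less :: "'a rel \<Rightarrow> 'a \<Rightarrow> 'a \<Rightarrow> bool" where
  "ord_less r a b \<longleftrightarrow> (a, b) \<in> r \<and> a \<noteq> b"

abbreviation ord_le_syn ("(_/ \<preceq>\<^bsub>_\<^esub> _)" [51, 0, 51] 50) where "a \<preceq>\<^bsub>r\<^esub> b \<equiv> ord_le r a b"
abbreviation ord_less_syn ("(_/ \<prec>\<^bsub>_\<^esub> _)" [51, 0, 51] 50) where "a \<prec>\<^bsub>r\<^esub> b \<equiv> ord_less r a b"

locale ordered_field_rel =
  fixes r :: "'a::field rel"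
  assumes field_ordering: "field_ordering r"
begin

text \<open>Only the order varies with \<open>r\<close> while the operations stay those of the type,
  so the facts about ordered fields become available for every ordering. The rewrites identify
  powers, numerals and sums formed inside the locale with the usual ones.\<close>

sublocale linordered_field "(/)" inverse "(*)" 1 "(+)" 0 "(-)" uminus
  "ord_le r" "ord_less r" "\<lambda>a. if a = 0 then 0 else if 0 \<prec>\<^bsub>r\<^esub> a then 1 else - 1" "\<lambda>a. if a \<prec>\<^bsub>r\<^esub> 0 then - a else a"
  rewrites power_eq: "power.power (1::'a) (*) = (^)"
    and of_nat_eq: "semiring_1.of_nat (1::'a) (+) 0 = of_nat"
    and numeral_eq: "numeral.numeral (1::'a) (+) = numeral"
    and sum_eq: "comm_monoid_add.sum (+) (0::'a) = sum"
proof -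
  have lin: "refl r" "trans r" "antisym r" "total r"
    and add: "\<And>x y z. (x, y) \<in> r \<Longrightarrow> (x + z, y + z) \<in> r"
    and mult: "\<And>x y. (0, x) \<in> r \<Longrightarrow> (0, y) \<in> r \<Longrightarrow> (0, x * y) \<in> r"
    using field_ordering
    unfolding field_ordering_def linear_order_on_def partial_order_on_def preorder_on_def by metis+
  show "class.linordered_field (/) inverse (*) (1::'a) (+) 0 (-) uminus
     (ord_le r) (ord_less r) (\<lambda>a. if a = 0 then 0 else if 0 \<prec>\<^bsub>r\<^esub> a then 1 else - 1) (\<lambda>a. if a \<prec>\<^bsub>r\<^esub> 0 then - a else a)"
  proof unfold_locales
    show total: "a \<preceq>\<^bsub>r\<^esub> b \<or> b \<preceq>\<^bsub>r\<^esub> a" for a b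
      using lin(1,4) unfolding ord_le_def by (metis refl_onD total_on_def UNIV_I)
    show antisym: "a = b" if "a \<preceq>\<^bsub>r\<^esub> b" "b \<preceq>\<^bsub>r\<^esub> a" for a b
      using lin(3) that unfolding ord_le_def by (meson antisymD)
    show "a \<prec>\<^bsub>r\<^esub> b \<longleftrightarrow> a \<preceq>\<^bsub>r\<^esub> b \<and> \<not> b \<preceq>\<^bsub>r\<^esub> a" for a b
      using antisym total by (auto simp: ord_less_def ord_le_def)
    show "a \<preceq>\<^bsub>r\<^esub> a" for a using total by blast
    show "a \<preceq>\<^bsub>r\<^esub> c" if "a \<preceq>\<^bsub>r\<^esub> b" "b \<preceq>\<^bsub>r\<^esub> c" for a b c
      using that lin(2) unfolding ord_le_def by (meson transD)
    show "c + a \<preceq>\<^bsub>r\<^esub> c + b" if "a \<preceq>\<^bsub>r\<^esub> b" for a b c using add that by (simp add: add.commute ord_le_def)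
    show "c * a \<prec>\<^bsub>r\<^esub> c * b" if "a \<prec>\<^bsub>r\<^esub> b" "0 \<prec>\<^bsub>r\<^esub> c" for a b c
    proof -
      have "(0, c * (b - a)) \<in> r" using that add[of a b "-a"] by (intro mult) (auto simp: ord_less_def)
      from add[OF this, of "c * a"] show ?thesis using that by (auto simp: ord_less_def algebra_simps)
    qed
  qed (auto simp: ord_less_def)
  have "power.power (1::'a) (*) a n = a ^ n" for a n
    by (induction n) (simp_all add: power.power.simps)
  then show "power.power (1::'a) (*) = (^)" by blast
  have "semiring_1.of_nat (1::'a) (+) 0 n = of_nat n" for n
    by (induction n) (simp_all add: semiring_1.of_nat_simps[OF semiring_1_class.semiring_1_axioms])
  then show "semiring_1.of_nat (1::'a) (+) 0 = of_nat" by blast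
  show "numeral.numeral (1::'a) (+) = numeral"
  proof
    show "numeral.numeral (1::'a) (+) k = numeral k" for k
      by (induction k) (simp_all only: numeral.numeral.simps[OF numeral_class.numeral_axioms] numeral_class.numeral.simps)
  qed
  show "comm_monoid_add.sum (+) (0::'a) = sum" by (simp only: sum_def comm_monoid_add.sum_def[OF comm_monoid_add_class.comm_monoid_add_axioms])
qed

section \<open>Polynomial inequalities for elements above 4\<close>

lemma four_less_mult:
  assumes "4 \<prec>\<^bsub>r\<^esub> h" "4 \<prec>\<^bsub>r\<^esub> k"
  shows "4 \<prec>\<^bsub>r\<^esub> h * k"
proof -
  have "0 \<prec>\<^bsub>r\<^esub> (h - 4) * (k - 4) + 4 * (h - 4) + 4 * (k - 4) + 12"
    using assms by (intro add_nonneg_pos add_nonneg_nonneg mult_nonneg_nonneg) auto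
  also have "\<dots> = h * k - 4" by (simp add: algebra_simps)
  finally show ?thesis by simp
qed

text \<open>For \<open>h, k > 4\<close> one has \<open>2 * (h + k) <= h * k\<close>, which leaves
  room for \<open>(a - b)^2 <= 2 * a^2 + 2 * b^2\<close>. For sums and differences, the gap between
  the two sides is written as a sum of visibly nonnegative terms.\<close>

lemma le_square_bound:
  assumes "4 \<prec>\<^bsub>r\<^esub> h" "4 \<prec>\<^bsub>r\<^esub> k" "a\<^sup>2 \<preceq>\<^bsub>r\<^esub> h" "b\<^sup>2 \<preceq>\<^bsub>r\<^esub> k"
  shows "a\<^sup>2 + b\<^sup>2 \<preceq>\<^bsub>r\<^esub> h * k" "(a - b)\<^sup>2 \<preceq>\<^bsub>r\<^esub> h * k" "(a * b)\<^sup>2 \<preceq>\<^bsub>r\<^esub> h * k"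
proof -
  have h: "0 \<preceq>\<^bsub>r\<^esub> h - 4" and k: "0 \<preceq>\<^bsub>r\<^esub> k - 4"
    using assms by simp_all
  have pos: "0 \<prec>\<^bsub>r\<^esub> h" "0 \<prec>\<^bsub>r\<^esub> k"
    using assms(1,2) zero_less_numeral less_trans by blast+
  have "0 \<preceq>\<^bsub>r\<^esub> (a + b)\<^sup>2 + ((h - 4) * (k - 4) + 2 * (h - 4) + 2 * (k - 4)) + 2 * (h - a\<^sup>2) + 2 * (k - b\<^sup>2)"
    using h k assms(3,4) by (intro add_nonneg_nonneg mult_nonneg_nonneg) auto
  also have "\<dots> = h * k - (a - b)\<^sup>2" by (simp add: algebra_simps power2_eq_square)
  finally show "(a - b)\<^sup>2 \<preceq>\<^bsub>r\<^esub> h * k" by simp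
  have "0 \<preceq>\<^bsub>r\<^esub> ((h - 4) * (k - 4) + 3 * (h - 4) + 3 * (k - 4)) + 8 + (h - a\<^sup>2) + (k - b\<^sup>2)"
    using h k assms(3,4) by (intro add_nonneg_nonneg mult_nonneg_nonneg) auto
  also have "\<dots> = h * k - (a\<^sup>2 + b\<^sup>2)" by (simp add: algebra_simps)
  finally show "a\<^sup>2 + b\<^sup>2 \<preceq>\<^bsub>r\<^esub> h * k" by simp
  show "(a * b)\<^sup>2 \<preceq>\<^bsub>r\<^esub> h * k"
    unfolding power_mult_distrib using assms(3,4) pos by (intro mult_mono) auto
qed

lemma square_between:
  assumes "a \<preceq>\<^bsub>r\<^esub> y" "y \<preceq>\<^bsub>r\<^esub> b"
  shows "y\<^sup>2 \<preceq>\<^bsub>r\<^esub> a\<^sup>2 + b\<^sup>2"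
proof (cases "0 \<preceq>\<^bsub>r\<^esub> y")
  case True
  then have "y\<^sup>2 \<preceq>\<^bsub>r\<^esub> b\<^sup>2" using assms(2) by (simp add: power_mono)
  then show ?thesis by (metis add_increasing zero_le_power2)
next
  case False
  then have "(- y)\<^sup>2 \<preceq>\<^bsub>r\<^esub> (- a)\<^sup>2" using assms(1) by (intro power_mono) auto
  then show ?thesis by (metis add_increasing2 power2_minus zero_le_power2)
qed

lemma four_lessD:
  assumes "4 \<prec>\<^bsub>r\<^esub> a"
  shows "1 \<prec>\<^bsub>r\<^esub> a" "0 \<prec>\<^bsub>r\<^esub> a" "a \<prec>\<^bsub>r\<^esub> a\<^sup>2"
proof -
  have "1 \<prec>\<^bsub>r\<^esub> 4" by simp
  then show "1 \<prec>\<^bsub>r\<^esub> a" using assms by (rule less_trans)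
  then show "0 \<prec>\<^bsub>r\<^esub> a" by (rule less_trans[OF zero_less_one])
  with \<open>1 \<prec>\<^bsub>r\<^esub> a\<close> have "a * 1 \<prec>\<^bsub>r\<^esub> a * a" by (rule mult_strict_left_mono)
  then show "a \<prec>\<^bsub>r\<^esub> a\<^sup>2" by (simp only: power2_eq_square mult_1_right)
qed

text \<open>
  Convexity of \<open>separable_ring r s\<close> below rests on the element \<open>h\<^sup>3 / (h + y\<^sup>2)\<close>: if \<open>y\<^sup>2 \<le> h\<close> for \<open>r\<close>,
  then it is at least \<open>h\<^sup>2/2\<close> for \<open>r\<close>, while its inverse \<open>1/h\<^sup>2 + y\<^sup>2/h\<^sup>3\<close> dominates \<open>y\<^sup>2\<close> for \<open>s\<close>
  whatever the size of \<open>y\<close> there.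
\<close>

lemma interpolant_bound_le:
  assumes "4 \<prec>\<^bsub>r\<^esub> h" "y\<^sup>2 \<preceq>\<^bsub>r\<^esub> h"
  shows "4 \<prec>\<^bsub>r\<^esub> h ^ 3 / (h + y\<^sup>2)" "y\<^sup>2 \<preceq>\<^bsub>r\<^esub> h ^ 3 / (h + y\<^sup>2)"
proof -
  have h: "0 \<prec>\<^bsub>r\<^esub> h" using assms(1) zero_less_numeral less_trans by blast
  then have d: "0 \<prec>\<^bsub>r\<^esub> h + y\<^sup>2" by (simp add: add_pos_nonneg)
  \<comment> \<open>The hypotheses enter as \<open>h - 4 >= 0\<close> and
    \<open>h - y^2 >= 0\<close>. The resulting lower bound \<open>2 * h\<close> for the quotient
    already exceeds \<open>h\<close>.\<close>
  have "0 \<preceq>\<^bsub>r\<^esub> h * (h * (h - 4) + 2 * (h - y\<^sup>2))"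
    using h assms by (intro add_nonneg_nonneg mult_nonneg_nonneg) (auto simp: order.strict_implies_order)
  also have "\<dots> = h ^ 3 - 2 * h * (h + y\<^sup>2)" by (simp add: algebra_simps power3_eq_cube)
  finally have "2 * h \<preceq>\<^bsub>r\<^esub> h ^ 3 / (h + y\<^sup>2)" using d by (simp add: pos_le_divide_eq)
  moreover have "h \<prec>\<^bsub>r\<^esub> 2 * h" using add_strict_left_mono[OF h, of h] by (simp only: mult_2 add_0_right)
  ultimately have "h \<preceq>\<^bsub>r\<^esub> h ^ 3 / (h + y\<^sup>2)" using less_le_trans order.strict_implies_order by blast
  then show "4 \<prec>\<^bsub>r\<^esub> h ^ 3 / (h + y\<^sup>2)" "y\<^sup>2 \<preceq>\<^bsub>r\<^esub> h ^ 3 / (h + y\<^sup>2)"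
    using assms less_le_trans order_trans by blast+
qed

lemma interpolant_bound_inverse:
  assumes "4 \<prec>\<^bsub>r\<^esub> inverse h"
  shows "4 \<prec>\<^bsub>r\<^esub> inverse (h ^ 3 / (h + y\<^sup>2))" "y\<^sup>2 \<preceq>\<^bsub>r\<^esub> inverse (h ^ 3 / (h + y\<^sup>2))"
proof -
  define g where "g = inverse h"
  have g4: "4 \<prec>\<^bsub>r\<^esub> g" using assms by (simp add: g_def)
  note g = four_lessD(1,2)[OF g4]
  have "h \<noteq> 0" using g by (auto simp: g_def)
  then have eq: "inverse (h ^ 3 / (h + y\<^sup>2)) = g\<^sup>2 + y\<^sup>2 * g ^ 3"
    by (simp add: g_def field_simps power2_eq_square power3_eq_cube)
  have "1 * g \<preceq>\<^bsub>r\<^esub> g * g" using g by (intro mult_right_mono) auto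
  then have "g \<preceq>\<^bsub>r\<^esub> g\<^sup>2" by (simp add: power2_eq_square)
  then have g2: "4 \<prec>\<^bsub>r\<^esub> g\<^sup>2" using g4 less_le_trans by blast
  have "1 \<preceq>\<^bsub>r\<^esub> g ^ 3" using g by (intro one_le_power) auto
  then have "y\<^sup>2 * 1 \<preceq>\<^bsub>r\<^esub> y\<^sup>2 * g ^ 3" by (intro mult_left_mono) auto
  then have y: "y\<^sup>2 \<preceq>\<^bsub>r\<^esub> y\<^sup>2 * g ^ 3" by simp
  then have y0: "0 \<preceq>\<^bsub>r\<^esub> y\<^sup>2 * g ^ 3" using order_trans[OF zero_le_power2] by blast
  show "4 \<prec>\<^bsub>r\<^esub> inverse (h ^ 3 / (h + y\<^sup>2))"
    unfolding eq using y0 g2 add_mono[of 4 "g\<^sup>2" 0] by (metis add.right_neutral add_less_le_mono)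
  show "y\<^sup>2 \<preceq>\<^bsub>r\<^esub> inverse (h ^ 3 / (h + y\<^sup>2))"
    unfolding eq using y by (rule add_increasing[OF zero_le_power2])
qed

text \<open>This is the induction step of Bernoulli's inequality. Arbitrary factors \<open>h\<close>
  and \<open>f\<close> are allowed so that it applies to a product for one ordering and to its
  inverse for another.\<close>

lemma bernoulli_step:
  assumes "0 \<prec>\<^bsub>r\<^esub> e" "1 + e \<preceq>\<^bsub>r\<^esub> f" "1 + of_nat k * e \<preceq>\<^bsub>r\<^esub> h"
  shows "1 + of_nat (Suc k) * e \<preceq>\<^bsub>r\<^esub> h * f"
proof -
  have ke: "0 \<preceq>\<^bsub>r\<^esub> of_nat k * e"
    using assms(1) by simp
  then have "0 \<preceq>\<^bsub>r\<^esub> 1 + of_nat k * e" "0 \<preceq>\<^bsub>r\<^esub> 1 + e"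
    using assms(1) by (simp_all add: add_nonneg_nonneg)
  then have h: "0 \<preceq>\<^bsub>r\<^esub> h" using assms(3) by order
  have "1 + of_nat (Suc k) * e \<preceq>\<^bsub>r\<^esub> (1 + of_nat k * e) * (1 + e)"
    using assms(1) by (simp add: algebra_simps)
  also have "(1 + of_nat k * e) * (1 + e) \<preceq>\<^bsub>r\<^esub> h * f"
    using assms \<open>0 \<preceq>\<^bsub>r\<^esub> 1 + e\<close> h by (intro mult_mono) auto
  finally show ?thesis .
qed

end

lemma ordered_field_relI: "r \<in> field_orderings \<Longrightarrow> ordered_field_rel r"
  by (simp add: field_orderings_def ordered_field_rel_def)

text \<open>For a field ordering these turn out to be valuation rings; see
  \<open>convex_subring_or_inverse\<close>.\<close>

definition convex_subring :: "'a::field rel \<Rightarrow> 'a set \<Rightarrow> bool" where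
  "convex_subring r A \<longleftrightarrow>
     1 \<in> A \<and> (\<forall>a\<in>A. \<forall>b\<in>A. a - b \<in> A \<and> a * b \<in> A) \<and> convex_wrt r A"

lemma convex_subring_of_nat: "convex_subring r A \<Longrightarrow> of_nat n \<in> A"
proof (induction n)
  case 0
  then have "1 - 1 \<in> A" unfolding convex_subring_def by blast
  then show ?case by simp
next
  case (Suc n)
  then have "1 \<in> A" "of_nat n \<in> A" "1 - 1 \<in> A" unfolding convex_subring_def by blast+
  then have "1 - (1 - 1 - of_nat n) \<in> A" using Suc.prems unfolding convex_subring_def by blast
  then show ?case by (simp add: algebra_simps)
qed

section \<open>Elements separating two orderings\<close>

text \<open>
  The bound 4 gives \<open>2 * (h + k) \<le> h * k\<close>, so that products of separating elements also
  bound squares of differences.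
\<close>

definition separates :: "'a::field rel \<Rightarrow> 'a rel \<Rightarrow> 'a \<Rightarrow> bool" where
  "separates r s h \<longleftrightarrow> 4 \<prec>\<^bsub>r\<^esub> h \<and> 4 \<prec>\<^bsub>s\<^esub> inverse h"

lemma separates_commute: "separates r s h \<Longrightarrow> separates s r (inverse h)"
  by (simp add: separates_def)

text \<open>Squares stand in for absolute values, which would depend on the ordering. Passing from
  \<open>h\<close> to its inverse exchanges the two orderings, so the set is symmetric in
  them.\<close>

definition separable_ring :: "'a::field rel \<Rightarrow> 'a rel \<Rightarrow> 'a set" where
  "separable_ring r s = {a. \<exists>h. separates r s h \<and> a\<^sup>2 \<preceq>\<^bsub>r\<^esub> h \<and> a\<^sup>2 \<preceq>\<^bsub>s\<^esub> inverse h}"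

lemma separable_ring_commute: "separable_ring r s = separable_ring s r"
proof -
  have "a \<in> separable_ring s r" if "a \<in> separable_ring r s" for a and r s :: "'a::field rel"
  proof -
    obtain h where h: "separates r s h" "a\<^sup>2 \<preceq>\<^bsub>r\<^esub> h" "a\<^sup>2 \<preceq>\<^bsub>s\<^esub> inverse h"
      using \<open>a \<in> separable_ring r s\<close> unfolding separable_ring_def by blast
    then show ?thesis
      unfolding separable_ring_def using separates_commute[OF h(1)] by (intro CollectI exI[of _ "inverse h"]) simp
  qed
  then show ?thesis by blast
qed

locale two_orderings = R: ordered_field_rel r + S: ordered_field_rel s
  for r s :: "'a::field rel"
begin

lemma commute: "two_orderings s r" ..

lemma convex_wrt_separable_ring: "convex_wrt r (separable_ring r s)"
  unfolding convex_wrt_def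
proof (intro ballI allI impI)
  fix a b y assume "a \<in> separable_ring r s" "b \<in> separable_ring r s" and y: "(a, y) \<in> r" "(y, b) \<in> r"
  then obtain h k where h: "separates r s h" "a\<^sup>2 \<preceq>\<^bsub>r\<^esub> h" "a\<^sup>2 \<preceq>\<^bsub>s\<^esub> inverse h"
    and k: "separates r s k" "b\<^sup>2 \<preceq>\<^bsub>r\<^esub> k" "b\<^sup>2 \<preceq>\<^bsub>s\<^esub> inverse k"
    unfolding separable_ring_def by blast
  have "y\<^sup>2 \<preceq>\<^bsub>r\<^esub> h * k"
    using R.square_between[of a y b] R.le_square_bound(1)[of h k a b] h k y R.order_trans
    unfolding separates_def ord_le_def by blast
  moreover have "4 \<prec>\<^bsub>r\<^esub> h * k" "4 \<prec>\<^bsub>s\<^esub> inverse (h * k)"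
    using h k R.four_less_mult S.four_less_mult[of "inverse h" "inverse k"]
    by (auto simp: separates_def)
  \<comment> \<open>The product \<open>h * k\<close> bounds \<open>y^2\<close> for \<open>r\<close>
    only. The witness is therefore \<open>(h * k)^3 / (h * k + y^2)\<close>, which also works for
    \<open>s\<close>, where nothing is known about \<open>y\<close>.\<close>
  ultimately show "y \<in> separable_ring r s"
    using R.interpolant_bound_le S.interpolant_bound_inverse
    unfolding separable_ring_def separates_def by blast
qed

text \<open>The product of two separating elements separates again and bounds the squares of
  differences and products. The given separating element bounds 1.\<close>

lemma convex_subring_separable_ring:
  assumes "separates r s h"
  shows "convex_subring r (separable_ring r s)"
  unfolding convex_subring_def
proof (intro conjI ballI convex_wrt_separable_ring)
  have "1 \<prec>\<^bsub>r\<^esub> 4" "1 \<prec>\<^bsub>s\<^esub> 4" by simp_all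
  then have "1\<^sup>2 \<preceq>\<^bsub>r\<^esub> h" "1\<^sup>2 \<preceq>\<^bsub>s\<^esub> inverse h"
    using assms R.less_trans[of 1 4 h] S.less_trans[of 1 4 "inverse h"]
    by (simp_all add: separates_def R.less_imp_le S.less_imp_le)
  then show "1 \<in> separable_ring r s"
    unfolding separable_ring_def using assms by blast
next
  fix a b assume "a \<in> separable_ring r s" "b \<in> separable_ring r s"
  then obtain h k where h: "separates r s h" "a\<^sup>2 \<preceq>\<^bsub>r\<^esub> h" "a\<^sup>2 \<preceq>\<^bsub>s\<^esub> inverse h"
    and k: "separates r s k" "b\<^sup>2 \<preceq>\<^bsub>r\<^esub> k" "b\<^sup>2 \<preceq>\<^bsub>s\<^esub> inverse k"
    unfolding separable_ring_def by blast
  have "separates r s (h * k)"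
    using h(1) k(1) R.four_less_mult[of h k] S.four_less_mult[of "inverse h" "inverse k"]
    by (simp add: separates_def)
  moreover have "(a - b)\<^sup>2 \<preceq>\<^bsub>r\<^esub> h * k" "(a * b)\<^sup>2 \<preceq>\<^bsub>r\<^esub> h * k"
    using R.le_square_bound(2,3)[OF _ _ h(2) k(2)] h(1) k(1) unfolding separates_def by blast+
  moreover have "(a - b)\<^sup>2 \<preceq>\<^bsub>s\<^esub> inverse (h * k)" "(a * b)\<^sup>2 \<preceq>\<^bsub>s\<^esub> inverse (h * k)"
    using S.le_square_bound(2,3)[OF _ _ h(3) k(3)] h(1) k(1)
    unfolding separates_def inverse_mult_distrib by blast+
  ultimately show "a - b \<in> separable_ring r s" "a * b \<in> separable_ring r s"
    unfolding separable_ring_def by blast+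
qed

end

section \<open>Elements that are finite for both orderings\<close>

definition finite_ring :: "'a::field rel \<Rightarrow> 'a rel \<Rightarrow> 'a set" where
  "finite_ring r s = {a. \<exists>m::nat. a\<^sup>2 \<preceq>\<^bsub>r\<^esub> of_nat m \<and> a\<^sup>2 \<preceq>\<^bsub>s\<^esub> of_nat m}"

lemma finite_ring_commute: "finite_ring r s = finite_ring s r"
  unfolding finite_ring_def by auto

context two_orderings
begin

lemma finite_ringE:
  assumes "a \<in> finite_ring r s"
  obtains m :: nat where "4 \<prec>\<^bsub>r\<^esub> of_nat m" "4 \<prec>\<^bsub>s\<^esub> of_nat m" "a\<^sup>2 \<preceq>\<^bsub>r\<^esub> of_nat m" "a\<^sup>2 \<preceq>\<^bsub>s\<^esub> of_nat m"
proof -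
  obtain m :: nat where m: "a\<^sup>2 \<preceq>\<^bsub>r\<^esub> of_nat m" "a\<^sup>2 \<preceq>\<^bsub>s\<^esub> of_nat m"
    using assms unfolding finite_ring_def by blast
  \<comment> \<open>Adding 5 raises any natural bound above 4, as the product estimates
    require.\<close>
  have "4 \<prec>\<^bsub>r\<^esub> of_nat (m + 5)" "4 \<prec>\<^bsub>s\<^esub> of_nat (m + 5)"
    using R.of_nat_less_iff[of 4 "m + 5"] S.of_nat_less_iff[of 4 "m + 5"] by simp_all
  moreover have "a\<^sup>2 \<preceq>\<^bsub>r\<^esub> of_nat (m + 5)" "a\<^sup>2 \<preceq>\<^bsub>s\<^esub> of_nat (m + 5)"
    using m by (simp_all add: R.add_increasing2 S.add_increasing2)
  ultimately show ?thesis using that by blast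
qed

text \<open>The case to exclude is \<open>y^2 <= N\<close> for \<open>r\<close> but
  \<open>y^2 > 20 * N\<close> for \<open>s\<close>: then \<open>5 * N / y^2\<close> would separate
  the two orderings.\<close>

lemma convex_wrt_finite_ring:
  assumes "\<nexists>h. separates r s h"
  shows "convex_wrt r (finite_ring r s)"
  unfolding convex_wrt_def
proof (intro ballI allI impI)
  fix a b y assume "a \<in> finite_ring r s" "b \<in> finite_ring r s" and y: "(a, y) \<in> r" "(y, b) \<in> r"
  then obtain m n where m: "4 \<prec>\<^bsub>r\<^esub> of_nat m" "4 \<prec>\<^bsub>s\<^esub> of_nat m" "a\<^sup>2 \<preceq>\<^bsub>r\<^esub> of_nat m"
    and n: "4 \<prec>\<^bsub>r\<^esub> of_nat n" "4 \<prec>\<^bsub>s\<^esub> of_nat n" "b\<^sup>2 \<preceq>\<^bsub>r\<^esub> of_nat n"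
    by (metis finite_ringE)
  define N where "N = m * n"
  have "y\<^sup>2 \<preceq>\<^bsub>r\<^esub> of_nat m * of_nat n"
    using R.square_between[of a y b] R.le_square_bound(1)[OF m(1) n(1)] m(3) n(3) y R.order_trans
    unfolding ord_le_def by blast
  then have yN: "y\<^sup>2 \<preceq>\<^bsub>r\<^esub> of_nat N" by (simp add: N_def)
  have N4: "4 \<prec>\<^bsub>r\<^esub> of_nat N" "4 \<prec>\<^bsub>s\<^esub> of_nat N"
    using R.four_less_mult[OF m(1) n(1)] S.four_less_mult[OF m(2) n(2)] by (simp_all add: N_def)
  \<comment> \<open>Here 20 is 4 times 5: the 5 lifts \<open>5 * N / y^2\<close> above 4 for
    \<open>r\<close>, and the 4 lifts its inverse above 4 for \<open>s\<close>.\<close>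
  have "y\<^sup>2 \<preceq>\<^bsub>s\<^esub> of_nat (20 * N)"
  proof (rule ccontr)
    assume "\<not> ?thesis"
    then have ys: "of_nat (20 * N) \<prec>\<^bsub>s\<^esub> y\<^sup>2" by simp
    have "0 \<preceq>\<^bsub>s\<^esub> of_nat (20 * N)" by (rule S.of_nat_0_le_iff)
    then have "y \<noteq> 0" using ys by (metis S.leD zero_power2)
    then have y0: "0 \<prec>\<^bsub>r\<^esub> y\<^sup>2" "0 \<prec>\<^bsub>s\<^esub> y\<^sup>2" by simp_all
    have N0: "0 \<prec>\<^bsub>r\<^esub> of_nat N" "0 \<prec>\<^bsub>s\<^esub> of_nat N"
      using N4 R.less_trans S.less_trans R.zero_less_numeral S.zero_less_numeral by blast+
    have "4 \<prec>\<^bsub>r\<^esub> 5 * of_nat N / y\<^sup>2"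
    proof -
      have "4 * y\<^sup>2 \<preceq>\<^bsub>r\<^esub> 4 * of_nat N" using yN by (intro R.mult_left_mono) auto
      also have "4 * of_nat N \<prec>\<^bsub>r\<^esub> 5 * of_nat N" using N0 by (intro R.mult_strict_right_mono) auto
      finally show ?thesis using y0 by (simp add: R.pos_less_divide_eq)
    qed
    moreover have "4 \<prec>\<^bsub>s\<^esub> inverse (5 * of_nat N / y\<^sup>2)"
    proof -
      have "4 * (5 * of_nat N) \<prec>\<^bsub>s\<^esub> y\<^sup>2" using ys by simp
      moreover have "0 \<prec>\<^bsub>s\<^esub> 5 * of_nat N" using N0 by (intro S.mult_pos_pos) auto
      moreover have "inverse (5 * of_nat N / y\<^sup>2) = y\<^sup>2 / (5 * of_nat N)" by simp
      ultimately show ?thesis by (simp only: S.pos_less_divide_eq)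
    qed
    ultimately show False using assms unfolding separates_def by blast
  qed
  moreover have "y\<^sup>2 \<preceq>\<^bsub>r\<^esub> of_nat (20 * N)"
    using yN R.of_nat_le_iff[of N "20 * N"] R.order_trans by simp
  ultimately show "y \<in> finite_ring r s"
    unfolding finite_ring_def by blast
qed

end

section \<open>From a unit of different signs to a separating element\<close>

context ordered_field_rel
begin

text \<open>The square bound gives \<open>1/v <= N\<close>, hence \<open>v >= 1/N\<close>. Dividing
  by \<open>N\<close> yields the margin needed for Bernoulli's inequality.\<close>

lemma inverse_square_le_divide:
  assumes "4 \<prec>\<^bsub>r\<^esub> N" "0 \<prec>\<^bsub>r\<^esub> v" "(inverse v)\<^sup>2 \<preceq>\<^bsub>r\<^esub> N"
  shows "1 / N\<^sup>2 \<preceq>\<^bsub>r\<^esub> v / N"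
proof -
  note N = four_lessD(2,3)[OF assms(1)]
  have "(inverse v)\<^sup>2 \<preceq>\<^bsub>r\<^esub> N\<^sup>2" by (rule order_trans[OF assms(3) less_imp_le[OF N(2)]])
  then have "inverse v \<preceq>\<^bsub>r\<^esub> N" by (rule power2_le_imp_le) (rule less_imp_le[OF N(1)])
  then have "1 \<preceq>\<^bsub>r\<^esub> v * N" by (simp only: inverse_eq_divide pos_divide_le_eq[OF assms(2)] mult.commute[of v])
  then have "1 / N\<^sup>2 \<preceq>\<^bsub>r\<^esub> (v * N) / N\<^sup>2" by (rule divide_right_mono) (rule zero_le_power2)
  moreover have "N \<noteq> 0" using N(1) by auto
  then have "(v * N) / N\<^sup>2 = v / N" by (simp add: power2_eq_square)
  ultimately show ?thesis by (simp only:)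
qed

text \<open>Put \<open>e = 1/N^2\<close>. Since \<open>-u/N\<close> lies between \<open>e\<close>
  and 1, the element \<open>1 + u/N\<close> is positive and at most \<open>1 - e\<close>, and
  \<open>(1 + e) * (1 - e) <= 1\<close>.\<close>

lemma one_add_le_inverse:
  assumes "4 \<prec>\<^bsub>r\<^esub> N" "u \<prec>\<^bsub>r\<^esub> 0" "u\<^sup>2 \<preceq>\<^bsub>r\<^esub> N" "(inverse u)\<^sup>2 \<preceq>\<^bsub>r\<^esub> N"
  shows "1 + 1 / N\<^sup>2 \<preceq>\<^bsub>r\<^esub> inverse (1 + u / N)"
proof -
  define e where "e = 1 / N\<^sup>2"
  define f where "f = 1 + u / N"
  have f_eq: "f = 1 - (- u) / N" by (simp add: f_def)
  note N = four_lessD(2,3)[OF assms(1)]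
  have "e \<preceq>\<^bsub>r\<^esub> (- u) / N"
    unfolding e_def using assms by (intro inverse_square_le_divide) auto
  then have f: "f \<preceq>\<^bsub>r\<^esub> 1 - e" unfolding f_eq by (rule diff_left_mono)
  have "(- u)\<^sup>2 \<prec>\<^bsub>r\<^esub> N\<^sup>2" unfolding power2_minus using assms(3) N(2) by (rule le_less_trans)
  then have "- u \<prec>\<^bsub>r\<^esub> N" by (rule power2_less_imp_less) (rule less_imp_le[OF N(1)])
  then have "(- u) / N \<prec>\<^bsub>r\<^esub> 1" by (simp only: pos_divide_less_eq[OF N(1)] mult_1)
  then have f0: "0 \<prec>\<^bsub>r\<^esub> f" unfolding f_eq by (simp only: diff_gt_0_iff_gt)
  have e0: "0 \<preceq>\<^bsub>r\<^esub> e" by (simp add: e_def)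
  have "(1 + e) * f \<preceq>\<^bsub>r\<^esub> (1 + e) * (1 - e)"
    using f e0 by (intro mult_left_mono add_nonneg_nonneg) auto
  also have "\<dots> = 1 - e * e" by (simp add: algebra_simps)
  also have "1 - e * e \<preceq>\<^bsub>r\<^esub> 1"
    using diff_left_mono[OF zero_le_square[of e], of 1] by (simp only: diff_0_right)
  finally show ?thesis
    using f0 unfolding inverse_eq_divide e_def[symmetric] f_def[symmetric] by (simp only: pos_le_divide_eq)
qed

end

context two_orderings
begin

lemma convex_subring_finite_ring:
  assumes "\<nexists>h. separates r s h"
  shows "convex_subring r (finite_ring r s)"
  unfolding convex_subring_def
proof (intro conjI ballI convex_wrt_finite_ring assms)
  show "1 \<in> finite_ring r s" unfolding finite_ring_def by (intro CollectI exI[of _ 1]) simp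
next
  fix a b assume "a \<in> finite_ring r s" "b \<in> finite_ring r s"
  then obtain m n where m: "4 \<prec>\<^bsub>r\<^esub> of_nat m" "4 \<prec>\<^bsub>s\<^esub> of_nat m" "a\<^sup>2 \<preceq>\<^bsub>r\<^esub> of_nat m" "a\<^sup>2 \<preceq>\<^bsub>s\<^esub> of_nat m"
    and n: "4 \<prec>\<^bsub>r\<^esub> of_nat n" "4 \<prec>\<^bsub>s\<^esub> of_nat n" "b\<^sup>2 \<preceq>\<^bsub>r\<^esub> of_nat n" "b\<^sup>2 \<preceq>\<^bsub>s\<^esub> of_nat n"
    by (metis finite_ringE)
  show "a - b \<in> finite_ring r s" "a * b \<in> finite_ring r s"
    unfolding finite_ring_def
    using R.le_square_bound(2,3)[OF m(1) n(1) m(3) n(3)] S.le_square_bound(2,3)[OF m(2) n(2) m(4) n(4)]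
    by (intro CollectI exI[of _ "m * n"], simp)+
qed

text \<open>The element \<open>f = 1 + u/N\<close> is at least \<open>1 + e\<close> for
  \<open>r\<close>, and its inverse is at least \<open>1 + e\<close> for \<open>s\<close>, with
  \<open>e = 1/N^2\<close>. By Bernoulli's inequality a high power of \<open>f\<close>
  separates.\<close>

lemma ex_separates:
  assumes "u \<in> finite_ring r s" "inverse u \<in> finite_ring r s" "0 \<prec>\<^bsub>r\<^esub> u" "u \<prec>\<^bsub>s\<^esub> 0"
  shows "\<exists>h. separates r s h"
proof -
  obtain m n where m: "4 \<prec>\<^bsub>r\<^esub> of_nat m" "4 \<prec>\<^bsub>s\<^esub> of_nat m" "u\<^sup>2 \<preceq>\<^bsub>r\<^esub> of_nat m" "u\<^sup>2 \<preceq>\<^bsub>s\<^esub> of_nat m"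
    and n: "(inverse u)\<^sup>2 \<preceq>\<^bsub>r\<^esub> of_nat n" "(inverse u)\<^sup>2 \<preceq>\<^bsub>s\<^esub> of_nat n"
    using assms(1,2) by (metis finite_ringE)
  define N where "N = m + n"
  have *: "of_nat m \<preceq>\<^bsub>r\<^esub> of_nat N" "of_nat n \<preceq>\<^bsub>r\<^esub> of_nat N" "of_nat m \<preceq>\<^bsub>s\<^esub> of_nat N" "of_nat n \<preceq>\<^bsub>s\<^esub> of_nat N"
    by (simp_all add: N_def)
  have N: "4 \<prec>\<^bsub>r\<^esub> of_nat N" "4 \<prec>\<^bsub>s\<^esub> of_nat N"
    using R.less_le_trans[OF m(1) *(1)] S.less_le_trans[OF m(2) *(3)] by blast+
  have uN: "u\<^sup>2 \<preceq>\<^bsub>s\<^esub> of_nat N" "(inverse u)\<^sup>2 \<preceq>\<^bsub>r\<^esub> of_nat N" "(inverse u)\<^sup>2 \<preceq>\<^bsub>s\<^esub> of_nat N"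
    using S.order_trans[OF m(4) *(3)] R.order_trans[OF n(1) *(2)] S.order_trans[OF n(2) *(4)] by blast+
  define e :: 'a where "e = 1 / (of_nat N)\<^sup>2"
  define f where "f = 1 + u / of_nat N"
  have fr: "1 + e \<preceq>\<^bsub>r\<^esub> f"
    unfolding e_def f_def using R.inverse_square_le_divide[OF N(1) assms(3) uN(2)] by (rule R.add_left_mono)
  have fs: "1 + e \<preceq>\<^bsub>s\<^esub> inverse f"
    unfolding e_def f_def using N(2) assms(4) uN(1,3) by (rule S.one_add_le_inverse)
  have N0: "0 \<prec>\<^bsub>r\<^esub> of_nat N" "0 \<prec>\<^bsub>s\<^esub> of_nat N"
    using R.less_trans[OF R.zero_less_numeral N(1)] S.less_trans[OF S.zero_less_numeral N(2)] by blast+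
  then have e: "0 \<prec>\<^bsub>r\<^esub> e" "0 \<prec>\<^bsub>s\<^esub> e"
    unfolding e_def by (intro R.divide_pos_pos S.divide_pos_pos; simp)+
  have "\<exists>h. 1 + of_nat k * e \<preceq>\<^bsub>r\<^esub> h \<and> 1 + of_nat k * e \<preceq>\<^bsub>s\<^esub> inverse h" for k
  proof (induction k)
    case 0
    show ?case by (rule exI[of _ 1]) simp
  next
    case (Suc k)
    then obtain h where h: "1 + of_nat k * e \<preceq>\<^bsub>r\<^esub> h" "1 + of_nat k * e \<preceq>\<^bsub>s\<^esub> inverse h" by blast
    show ?case
      using R.bernoulli_step[OF e(1) fr h(1)] S.bernoulli_step[OF e(2) fs h(2)]
      by (intro exI[of _ "h * f"]) simp
  qed
  \<comment> \<open>As \<open>e = 1/N^2\<close>, the exponent \<open>4 * N^2\<close> turns the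
    Bernoulli bound into \<open>1 + 4 = 5\<close>.\<close>
  then obtain h where h: "1 + of_nat (4 * N\<^sup>2) * e \<preceq>\<^bsub>r\<^esub> h" "1 + of_nat (4 * N\<^sup>2) * e \<preceq>\<^bsub>s\<^esub> inverse h"
    by blast
  have "(of_nat N :: 'a) \<noteq> 0" using N0(1) by auto
  then have "1 + of_nat (4 * N\<^sup>2) * e = 5" by (simp add: e_def)
  from h[unfolded this] have "5 \<preceq>\<^bsub>r\<^esub> h" "5 \<preceq>\<^bsub>s\<^esub> inverse h" by blast+
  moreover have "4 \<prec>\<^bsub>r\<^esub> 5" "4 \<prec>\<^bsub>s\<^esub> 5" by simp_all
  ultimately have "separates r s h"
    unfolding separates_def by (blast intro: R.less_le_trans S.less_le_trans)
  then show ?thesis by blast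
qed

end

text \<open>The hypothesis on \<open>A\<close> is the form in which (I) is used. Applied to
  \<open>finite_ring r s\<close>, it refutes the absence of separating elements; applied then to
  \<open>separable_ring r s\<close>, it puts \<open>c\<close> into that ring. The result is a
  square, hence positive for every ordering.\<close>

lemma ex_square_separating:
  assumes "ordered_field_rel r" "ordered_field_rel s" "1 \<preceq>\<^bsub>r\<^esub> c" "1 \<preceq>\<^bsub>s\<^esub> c"
    and convex: "\<And>A. convex_subring r A \<Longrightarrow> convex_subring s A \<Longrightarrow>
      c \<in> A \<and> (\<exists>u\<in>A. inverse u \<in> A \<and> 0 \<prec>\<^bsub>r\<^esub> u \<and> u \<prec>\<^bsub>s\<^esub> 0)"
  shows "\<exists>h. h \<noteq> 0 \<and> c \<prec>\<^bsub>r\<^esub> h\<^sup>2 \<and> c \<prec>\<^bsub>s\<^esub> inverse (h\<^sup>2)"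
proof -
  interpret two_orderings r s using assms(1,2) by (simp add: two_orderings_def)
  interpret sr: two_orderings s r by (rule commute)
  have "\<exists>h. separates r s h"
  proof (rule ccontr)
    assume no: "\<not> ?thesis"
    then have "\<nexists>h. separates s r h" using separates_commute by blast
    then have "convex_subring r (finite_ring r s)" "convex_subring s (finite_ring r s)"
      using convex_subring_finite_ring[OF no] sr.convex_subring_finite_ring finite_ring_commute[of r s] by auto
    then show False using convex ex_separates no by blast
  qed
  then obtain k where k: "separates r s k" by blast
  have "convex_subring r (separable_ring r s)" "convex_subring s (separable_ring r s)"
    using convex_subring_separable_ring[OF k] sr.convex_subring_separable_ring[OF separates_commute[OF k]]
    by (simp_all add: separable_ring_commute[of r s])
  then have "c \<in> separable_ring r s" using convex by blast
  then obtain h where h: "separates r s h" "c\<^sup>2 \<preceq>\<^bsub>r\<^esub> h" "c\<^sup>2 \<preceq>\<^bsub>s\<^esub> inverse h"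
    unfolding separable_ring_def by blast
  \<comment> \<open>From \<open>g >= c^2 >= c\<close> and \<open>g > 4\<close> follows
    \<open>g^2 > g >= c\<close>. This serves \<open>h\<close> for \<open>r\<close> and its inverse
    for \<open>s\<close>.\<close>
  have gt: "c \<prec>\<^bsub>q\<^esub> g\<^sup>2" if "ordered_field_rel q" "1 \<preceq>\<^bsub>q\<^esub> c" "4 \<prec>\<^bsub>q\<^esub> g" "c\<^sup>2 \<preceq>\<^bsub>q\<^esub> g" for q g
  proof -
    interpret Q: ordered_field_rel q by fact
    have "0 \<preceq>\<^bsub>q\<^esub> c" using Q.order_trans[OF Q.zero_le_one that(2)] .
    then have "c * 1 \<preceq>\<^bsub>q\<^esub> c * c" using that(2) by (intro Q.mult_left_mono)
    then have "c \<preceq>\<^bsub>q\<^esub> g" using Q.order_trans[OF _ that(4)] by (simp add: power2_eq_square)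
    then show ?thesis by (rule Q.le_less_trans[OF _ Q.four_lessD(3)[OF that(3)]])
  qed
  have "c \<prec>\<^bsub>r\<^esub> h\<^sup>2" "c \<prec>\<^bsub>s\<^esub> (inverse h)\<^sup>2"
    using gt[of r h] gt[of s "inverse h"] assms h unfolding separates_def by blast+
  moreover have "h \<noteq> 0" using h(1) R.less_asym[of 4 0] by (auto simp: separates_def)
  ultimately show ?thesis by (intro exI[of _ h]) (simp add: power_inverse)
qed

section \<open>Compact sets of orderings\<close>

text \<open>With \<open>g = inverse c\<close> both squares are below \<open>g^2\<close>, and
  \<open>2 * g^2 <= c * g^2 = g\<close> because \<open>c >= 2\<close>.\<close>

lemma (in ordered_field_rel) square_add_square_less_inverse:
  assumes "2 \<preceq>\<^bsub>r\<^esub> c" "0 \<prec>\<^bsub>r\<^esub> h" "h \<prec>\<^bsub>r\<^esub> inverse c" "0 \<prec>\<^bsub>r\<^esub> k" "k \<prec>\<^bsub>r\<^esub> inverse c"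
  shows "h\<^sup>2 + k\<^sup>2 \<prec>\<^bsub>r\<^esub> inverse c"
proof -
  define g where "g = inverse c"
  have g: "0 \<prec>\<^bsub>r\<^esub> g" unfolding g_def by (rule less_trans[OF assms(2,3)])
  have c: "0 \<prec>\<^bsub>r\<^esub> c" by (rule less_le_trans[OF zero_less_numeral assms(1)])
  then have "c \<noteq> 0" by auto
  then have cg: "c * g = 1" by (simp add: g_def)
  have "h * h \<prec>\<^bsub>r\<^esub> g * g" "k * k \<prec>\<^bsub>r\<^esub> g * g"
    using mult_strict_mono[OF assms(3,3) g[unfolded g_def] less_imp_le[OF assms(2)]]
      mult_strict_mono[OF assms(5,5) g[unfolded g_def] less_imp_le[OF assms(4)]] by (simp_all only: g_def)
  then have "h * h + k * k \<prec>\<^bsub>r\<^esub> g * g + g * g" by (rule add_strict_mono)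
  also have "g * g + g * g = 2 * (g * g)" by (simp only: mult_2)
  also have "2 * (g * g) \<preceq>\<^bsub>r\<^esub> c * (g * g)"
    by (rule mult_right_mono[OF assms(1) zero_le_square])
  also have "c * (g * g) = g" using cg by (simp only: mult.assoc[symmetric] mult_1_left)
  finally show ?thesis by (simp only: g_def power2_eq_square)
qed

section \<open>Totally positive elements and finite subcovers\<close>

definition totally_positive :: "'a::field \<Rightarrow> bool" where
  "totally_positive h \<longleftrightarrow> (\<forall>r\<in>field_orderings. 0 \<prec>\<^bsub>r\<^esub> h)"

lemma totally_positive_square: "h \<noteq> 0 \<Longrightarrow> totally_positive (h\<^sup>2)"
  unfolding totally_positive_def
proof
  fix r :: "'a rel" assume "h \<noteq> 0" "r \<in> field_orderings"
  then interpret ordered_field_rel r by (intro ordered_field_relI)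
  show "0 \<prec>\<^bsub>r\<^esub> h\<^sup>2" using \<open>h \<noteq> 0\<close> by simp
qed

lemma totally_positive_inverse: "totally_positive h \<Longrightarrow> totally_positive (inverse h)"
  unfolding totally_positive_def
proof
  fix r :: "'a rel" assume h: "\<forall>r\<in>field_orderings. 0 \<prec>\<^bsub>r\<^esub> h" and r: "r \<in> field_orderings"
  then interpret ordered_field_rel r by (intro ordered_field_relI)
  show "0 \<prec>\<^bsub>r\<^esub> inverse h" using h r by simp
qed

lemma totally_positive_add: "totally_positive h \<Longrightarrow> totally_positive k \<Longrightarrow> totally_positive (h + k)"
  unfolding totally_positive_def
proof
  fix r :: "'a rel" assume h: "\<forall>r\<in>field_orderings. 0 \<prec>\<^bsub>r\<^esub> h" "\<forall>r\<in>field_orderings. 0 \<prec>\<^bsub>r\<^esub> k" and r: "r \<in> field_orderings"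
  then interpret ordered_field_rel r by (intro ordered_field_relI)
  show "0 \<prec>\<^bsub>r\<^esub> h + k" using h r by (intro add_pos_pos) auto
qed

lemma totally_positive_1: "totally_positive 1"
  using totally_positive_square[of 1] by simp

text \<open>For distinct \<open>a\<close> and \<open>b\<close> the strict inequality amounts to
  \<open>b - a >= 0\<close>, which defines a subbasic set; for \<open>a = b\<close> the set is
  empty.\<close>

lemma openin_harrison_topology: "openin harrison_topology {r \<in> field_orderings. a \<prec>\<^bsub>r\<^esub> b}"
proof (cases "a = b")
  case True
  then show ?thesis by (simp add: ord_less_def)
next
  case False
  have "a \<prec>\<^bsub>r\<^esub> b \<longleftrightarrow> (0, b - a) \<in> r" if "r \<in> field_orderings" for r
  proof -
    interpret ordered_field_rel r by (rule ordered_field_relI[OF that])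
    have "a \<prec>\<^bsub>r\<^esub> b \<longleftrightarrow> 0 \<preceq>\<^bsub>r\<^esub> b - a" unfolding diff_ge_0_iff_ge using False by (simp add: ord_less_def ord_le_def)
    then show ?thesis by (simp only: ord_le_def)
  qed
  then have "{r \<in> field_orderings. a \<prec>\<^bsub>r\<^esub> b} = {r \<in> field_orderings. (0, b - a) \<in> r}" by blast
  then show ?thesis
    unfolding harrison_topology_def by (simp only:) (rule topology_generated_by_Basis, blast)
qed

text \<open>A maximum would depend on the ordering, so the elements of \<open>F\<close> are merged
  through \<open>h^2 + k^2\<close>. This stays below \<open>1/c\<close> where both elements do and
  exceeds \<open>c\<close> where one of them does.\<close>

lemma ex_dominating:
  fixes c :: "'a::field"
  assumes c: "\<And>r. r \<in> field_orderings \<Longrightarrow> 2 \<preceq>\<^bsub>r\<^esub> c" and "T \<subseteq> field_orderings"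
    and "finite F" "F \<subseteq> {h. totally_positive h \<and> (\<forall>s\<in>T. h \<prec>\<^bsub>s\<^esub> inverse c)}"
  shows "\<exists>k. totally_positive k \<and> (\<forall>s\<in>T. k \<prec>\<^bsub>s\<^esub> inverse c) \<and>
    (\<forall>r\<in>field_orderings. \<forall>h\<in>F. c \<prec>\<^bsub>r\<^esub> h \<longrightarrow> c \<prec>\<^bsub>r\<^esub> k)"
  using assms(3,4)
proof (induction F)
  case empty
  have c0: "totally_positive c"
    unfolding totally_positive_def
  proof
    fix r :: "'a rel" assume r: "r \<in> field_orderings"
    then interpret ordered_field_rel r by (rule ordered_field_relI)
    show "0 \<prec>\<^bsub>r\<^esub> c" by (rule less_le_trans[OF zero_less_numeral c[OF r]])
  qed
  \<comment> \<open>For the empty family any totally positive element below \<open>1/c\<close> on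
    \<open>T\<close> will do.\<close>
  then have "totally_positive (inverse (c + 1))"
    by (intro totally_positive_inverse totally_positive_add totally_positive_1)
  moreover have "inverse (c + 1) \<prec>\<^bsub>s\<^esub> inverse c" if "s \<in> T" for s
  proof -
    have s: "s \<in> field_orderings" using that assms(2) by blast
    then interpret ordered_field_rel s by (rule ordered_field_relI)
    show ?thesis using c0 s less_add_one by (intro less_imp_inverse_less) (auto simp: totally_positive_def)
  qed
  ultimately show ?case by blast
next
  case (insert h F)
  then obtain k where k: "totally_positive k" "\<forall>s\<in>T. k \<prec>\<^bsub>s\<^esub> inverse c"
    "\<forall>r\<in>field_orderings. \<forall>g\<in>F. c \<prec>\<^bsub>r\<^esub> g \<longrightarrow> c \<prec>\<^bsub>r\<^esub> k" by blast
  have h: "totally_positive h" "\<And>s. s \<in> T \<Longrightarrow> h \<prec>\<^bsub>s\<^esub> inverse c" using insert.prems by auto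
  have gt: "c \<prec>\<^bsub>r\<^esub> h\<^sup>2 + k\<^sup>2"
    if r: "r \<in> field_orderings" and "c \<prec>\<^bsub>r\<^esub> h \<or> c \<prec>\<^bsub>r\<^esub> k" for r
  proof -
    interpret ordered_field_rel r by (rule ordered_field_relI[OF r])
    have "c \<prec>\<^bsub>r\<^esub> g\<^sup>2" if "c \<prec>\<^bsub>r\<^esub> g" for g
    proof -
      have "1 \<prec>\<^bsub>r\<^esub> c" by (rule less_le_trans[OF _ c[OF r]]) simp
      then have "1 \<prec>\<^bsub>r\<^esub> g" by (rule less_trans[OF _ that])
      then have "g * 1 \<prec>\<^bsub>r\<^esub> g * g" by (rule mult_strict_left_mono) (rule less_trans[OF zero_less_one \<open>1 \<prec>\<^bsub>r\<^esub> g\<close>])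
      then show ?thesis unfolding power2_eq_square mult_1_right by (rule less_trans[OF that])
    qed
    then show ?thesis
      using that(2) add_strict_increasing2[OF zero_le_power2[of h], of c "k\<^sup>2"]
        add_strict_increasing2[OF zero_le_power2[of k], of c "h\<^sup>2"] by (auto simp only: add.commute)
  qed
  have "totally_positive (h\<^sup>2 + k\<^sup>2)"
    unfolding totally_positive_def
  proof
    fix r :: "'a rel" assume r: "r \<in> field_orderings"
    then interpret ordered_field_rel r by (rule ordered_field_relI)
    show "0 \<prec>\<^bsub>r\<^esub> h\<^sup>2 + k\<^sup>2"
      using h(1) k(1) r by (intro add_pos_pos zero_less_power) (auto simp only: totally_positive_def)
  qed
  moreover have "h\<^sup>2 + k\<^sup>2 \<prec>\<^bsub>s\<^esub> inverse c" if "s \<in> T" for s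
  proof -
    have s: "s \<in> field_orderings" using that assms(2) by blast
    then interpret ordered_field_rel s by (rule ordered_field_relI)
    show ?thesis
      using h(1) k(1) s by (intro square_add_square_less_inverse c h(2) bspec[OF k(2)] that) (auto simp only: totally_positive_def)
  qed
  ultimately show ?case using gt k(3) by (intro exI[of _ "h\<^sup>2 + k\<^sup>2"]) blast
qed

text \<open>The sets on which a local choice of \<open>h\<close> exceeds \<open>c\<close> are open
  and cover \<open>S\<close>. A finite subcover leaves finitely many \<open>h\<close>, which
  \<open>ex_dominating\<close> merges.\<close>

lemma compact_bump:
  fixes c :: "'a::field"
  assumes "\<And>r. r \<in> field_orderings \<Longrightarrow> 2 \<preceq>\<^bsub>r\<^esub> c" and "T \<subseteq> field_orderings" "S \<subseteq> field_orderings"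
    and S: "compactin harrison_topology S"
    and loc: "\<And>r. r \<in> S \<Longrightarrow> \<exists>h. totally_positive h \<and> c \<prec>\<^bsub>r\<^esub> h \<and> (\<forall>s\<in>T. h \<prec>\<^bsub>s\<^esub> inverse c)"
  shows "\<exists>h. totally_positive h \<and> (\<forall>r\<in>S. c \<prec>\<^bsub>r\<^esub> h) \<and> (\<forall>s\<in>T. h \<prec>\<^bsub>s\<^esub> inverse c)"
proof -
  define U where "U h = {r \<in> field_orderings. c \<prec>\<^bsub>r\<^esub> h}" for h
  define E where "E = {h. totally_positive h \<and> (\<forall>s\<in>T. h \<prec>\<^bsub>s\<^esub> inverse c)}"
  have "S \<subseteq> \<Union> (U ` E)" using loc assms(3) unfolding U_def E_def by blast
  moreover have "\<forall>V\<in>U ` E. openin harrison_topology V" using openin_harrison_topology by (auto simp: U_def)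
  ultimately obtain \<F> where F: "finite \<F>" "\<F> \<subseteq> U ` E" "S \<subseteq> \<Union> \<F>"
    using S unfolding compactin_def by meson
  obtain F where "finite F" "F \<subseteq> E" "\<F> = U ` F" using finite_subset_image[OF F(1,2)] by blast
  with ex_dominating[OF assms(1,2), of F] F(3) assms(3) show ?thesis
    unfolding E_def U_def by fast
qed

text \<open>For fixed \<open>s\<close> in \<open>T\<close>, compactness of \<open>S\<close> gives an
  element large on \<open>S\<close> and small at \<open>s\<close>. Its inverse is large at
  \<open>s\<close> and small on \<open>S\<close>, so compactness of \<open>T\<close> makes the
  choice uniform, and a final inversion restores the roles.\<close>

lemma compact_separation:
  fixes c :: "'a::field"
  assumes c: "\<And>r. r \<in> field_orderings \<Longrightarrow> 2 \<preceq>\<^bsub>r\<^esub> c" and S: "S \<subseteq> field_orderings" "compactin harrison_topology S"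
    and T: "T \<subseteq> field_orderings" "compactin harrison_topology T"
    and sep: "\<And>r s. r \<in> S \<Longrightarrow> s \<in> T \<Longrightarrow> \<exists>h. h \<noteq> 0 \<and> c \<prec>\<^bsub>r\<^esub> h\<^sup>2 \<and> c \<prec>\<^bsub>s\<^esub> inverse (h\<^sup>2)"
  shows "\<exists>h. totally_positive h \<and> (\<forall>r\<in>S. c \<prec>\<^bsub>r\<^esub> h) \<and> (\<forall>s\<in>T. h \<prec>\<^bsub>s\<^esub> inverse c)"
proof -
  have inv: "inverse h \<prec>\<^bsub>r\<^esub> inverse c" if "r \<in> field_orderings" "c \<prec>\<^bsub>r\<^esub> h" for r h
  proof -
    interpret ordered_field_rel r by (rule ordered_field_relI[OF that(1)])
    show ?thesis
      by (rule less_imp_inverse_less[OF that(2)]) (rule less_le_trans[OF zero_less_numeral c[OF that(1)]])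
  qed
  have inv': "c \<prec>\<^bsub>r\<^esub> inverse h" if "r \<in> field_orderings" "h \<prec>\<^bsub>r\<^esub> inverse c" "totally_positive h" for r h
  proof -
    interpret ordered_field_rel r by (rule ordered_field_relI[OF that(1)])
    have "0 \<prec>\<^bsub>r\<^esub> h" using that by (simp only: totally_positive_def)
    from less_imp_inverse_less[OF that(2) this] show ?thesis by (simp only: inverse_inverse_eq)
  qed
  have "\<exists>h. totally_positive h \<and> c \<prec>\<^bsub>s\<^esub> h \<and> (\<forall>r\<in>S. h \<prec>\<^bsub>r\<^esub> inverse c)" if s: "s \<in> T" for s
  proof -
    have "\<exists>h. totally_positive h \<and> (\<forall>r\<in>S. c \<prec>\<^bsub>r\<^esub> h) \<and> (\<forall>s\<in>{s}. h \<prec>\<^bsub>s\<^esub> inverse c)"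
    proof (rule compact_bump[OF c])
      show "\<exists>h. totally_positive h \<and> c \<prec>\<^bsub>r\<^esub> h \<and> (\<forall>s\<in>{s}. h \<prec>\<^bsub>s\<^esub> inverse c)" if r: "r \<in> S" for r
      proof -
        obtain h where "h \<noteq> 0" "c \<prec>\<^bsub>r\<^esub> h\<^sup>2" "c \<prec>\<^bsub>s\<^esub> inverse (h\<^sup>2)" using sep[OF r s] by blast
        then show ?thesis using inv[of s "inverse (h\<^sup>2)"] s T(1) totally_positive_square[of h]
          by (intro exI[of _ "h\<^sup>2"]) auto
      qed
    qed (use S T s in auto)
    then obtain h where "totally_positive h" "\<forall>r\<in>S. c \<prec>\<^bsub>r\<^esub> h" "h \<prec>\<^bsub>s\<^esub> inverse c" by blast
    then show ?thesis
      using inv inv' totally_positive_inverse S(1) T(1) s by (intro exI[of _ "inverse h"]) blast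
  qed
  from compact_bump[OF c S(1) T this] obtain h where
    "totally_positive h" "\<forall>s\<in>T. c \<prec>\<^bsub>s\<^esub> h" "\<forall>r\<in>S. h \<prec>\<^bsub>r\<^esub> inverse c" by blast
  then show ?thesis
    using inv inv' totally_positive_inverse S(1) T(1) by (intro exI[of _ "inverse h"]) blast
qed

section \<open>The valuation of a convex subring\<close>

text \<open>Convexity puts the interval from -1 to 1 into \<open>A\<close>, and an element outside
  this interval has its inverse inside.\<close>

lemma (in ordered_field_rel) convex_subring_or_inverse:
  assumes A: "convex_subring r A"
  shows "x \<in> A \<or> inverse x \<in> A"
proof -
  have A01: "1 \<in> A" "0 \<in> A"
    using convex_subring_of_nat[OF A, of 1] convex_subring_of_nat[OF A, of 0] by simp_all
  then have "0 - 1 \<in> A" using A unfolding convex_subring_def by blast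
  then have unit_interval: "y \<in> A" if "- 1 \<preceq>\<^bsub>r\<^esub> y" "y \<preceq>\<^bsub>r\<^esub> 1" for y
    using that A A01(1) unfolding convex_subring_def convex_wrt_def ord_le_def by (metis diff_0)
  consider "- 1 \<preceq>\<^bsub>r\<^esub> x" "x \<preceq>\<^bsub>r\<^esub> 1" | "1 \<prec>\<^bsub>r\<^esub> x" | "1 \<prec>\<^bsub>r\<^esub> - x"
    using not_less[of 1 x] not_less[of 1 "- x"] minus_le_iff[of 1 x] by blast
  then show ?thesis
  proof cases
    case 1
    then show ?thesis using unit_interval by blast
  next
    case 2
    then have "0 \<prec>\<^bsub>r\<^esub> x" by (rule less_trans[OF zero_less_one])
    then have "0 \<preceq>\<^bsub>r\<^esub> inverse x" "inverse x \<preceq>\<^bsub>r\<^esub> 1"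
      using 2 less_imp_inverse_less[OF 2 zero_less_one] by simp_all
    then show ?thesis using unit_interval order_trans[of "- 1" 0 "inverse x"] by simp
  next
    case 3
    then have "0 \<prec>\<^bsub>r\<^esub> - x" by (rule less_trans[OF zero_less_one])
    then have "0 \<preceq>\<^bsub>r\<^esub> inverse (- x)" "inverse (- x) \<preceq>\<^bsub>r\<^esub> 1"
      using less_imp_inverse_less[OF 3 zero_less_one] by simp_all
    then have "- 1 \<preceq>\<^bsub>r\<^esub> inverse x" "inverse x \<preceq>\<^bsub>r\<^esub> 0"
      by simp_all
    then show ?thesis using unit_interval order_trans[of "inverse x" 0 1] by simp
  qed
qed

section \<open>Value group and residue orderings of a valuation subring\<close>

locale valuation_subring =
  fixes A :: "'a::field set"
  assumes one_mem: "1 \<in> A"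
    and diff_mem: "a \<in> A \<Longrightarrow> b \<in> A \<Longrightarrow> a - b \<in> A"
    and mult_mem: "a \<in> A \<Longrightarrow> b \<in> A \<Longrightarrow> a * b \<in> A"
    and mem_or_inverse: "x \<in> A \<or> inverse x \<in> A"
begin

lemma zero_mem: "0 \<in> A" using diff_mem[OF one_mem one_mem] by simp

lemma uminus_mem: "a \<in> A \<Longrightarrow> - a \<in> A" using diff_mem[OF zero_mem] by simp

lemma add_mem: "a \<in> A \<Longrightarrow> b \<in> A \<Longrightarrow> a + b \<in> A" using diff_mem[OF _ uminus_mem] by simp

text \<open>Divisibility with respect to \<open>A\<close> is the order of values. Division by 0
  gives 0, so \<open>divs 0 y\<close> always holds; this is why hypotheses of being nonzero
  accompany it.\<close>

definition divs :: "'a \<Rightarrow> 'a \<Rightarrow> bool" where "divs x y \<longleftrightarrow> y / x \<in> A"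

lemma divs_refl: "x \<noteq> 0 \<Longrightarrow> divs x x" by (simp add: divs_def one_mem)

lemma divs_trans: "divs x y \<Longrightarrow> divs y z \<Longrightarrow> y \<noteq> 0 \<Longrightarrow> divs x z"
  using mult_mem[of "y / x" "z / y"] by (simp add: divs_def)

lemma divs_mult: "divs x y \<Longrightarrow> divs u v \<Longrightarrow> divs (x * u) (y * v)"
  using mult_mem[of "y / x" "v / u"] by (simp add: divs_def)

lemma divs_total: "divs x y \<or> divs y x"
  using mem_or_inverse[of "y / x"] by (simp add: divs_def)

text \<open>For nonzero \<open>x\<close> this is the coset of \<open>x\<close> modulo the units of
  \<open>A\<close>. Being a subset of the field, it has the type to which the value groups in (I)
  are restricted.\<close>

definition value_class :: "'a \<Rightarrow> 'a set" where
  "value_class x = {y. y \<noteq> 0 \<and> divs x y \<and> divs y x}"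

lemma value_class_eq_iff:
  assumes "x \<noteq> 0" "y \<noteq> 0"
  shows "value_class x = value_class y \<longleftrightarrow> divs x y \<and> divs y x"
proof
  assume "value_class x = value_class y"
  moreover have "y \<in> value_class y" using assms by (simp add: value_class_def divs_refl)
  ultimately show "divs x y \<and> divs y x" by (auto simp: value_class_def)
next
  assume "divs x y \<and> divs y x"
  then show "value_class x = value_class y"
    using assms divs_trans unfolding value_class_def by blast
qed

text \<open>Cosets are multiplied through arbitrary representatives; \<open>value_group_mult\<close>
  shows that the choice does not matter.\<close>

definition value_group :: "'a set ordered_group" where
  "value_group = \<lparr>carrier = value_class ` (- {0}),
     mult = (\<lambda>X Y. value_class ((SOME x. x \<in> X) * (SOME y. y \<in> Y))),
     one = value_class 1,
     ord_rel = {(value_class x, value_class y) | x y. x \<noteq> 0 \<and> y \<noteq> 0 \<and> divs x y}\<rparr>"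

definition valuation :: "'a \<Rightarrow> 'a set option" where
  "valuation x = (if x = 0 then None else Some (value_class x))"

lemma value_group_mult:
  assumes "x \<noteq> 0" "y \<noteq> 0"
  shows "value_class x \<otimes>\<^bsub>value_group\<^esub> value_class y = value_class (x * y)"
proof -
  have some: "(SOME y. y \<in> value_class x) \<in> value_class x" if "x \<noteq> 0" for x
    using that someI[of "\<lambda>y. y \<in> value_class x" x] by (simp add: value_class_def divs_refl)
  define u v where "u = (SOME y. y \<in> value_class x)" and "v = (SOME z. z \<in> value_class y)"
  have "u \<in> value_class x" "v \<in> value_class y"
    using some assms by (simp_all add: u_def v_def)
  then have "value_class (u * v) = value_class (x * y)"
    using assms by (subst value_class_eq_iff) (auto simp: value_class_def divs_mult)
  then show ?thesis by (simp add: value_group_def u_def v_def)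
qed

lemma value_group_ord_rel:
  assumes "x \<noteq> 0" "y \<noteq> 0"
  shows "(value_class x, value_class y) \<in> ord_rel value_group \<longleftrightarrow> divs x y"
proof
  assume "(value_class x, value_class y) \<in> ord_rel value_group"
  then obtain u v where uv: "value_class x = value_class u" "value_class y = value_class v"
    "u \<noteq> 0" "v \<noteq> 0" "divs u v" by (auto simp: value_group_def)
  then have "divs x u" "divs v y" using assms value_class_eq_iff by blast+
  then show "divs x y" using uv divs_trans by blast
qed (use assms in \<open>auto simp: value_group_def\<close>)

lemma ordered_abelian_group_value_group: "ordered_abelian_group value_group"
proof -
  have C: "carrier value_group = value_class ` (- {0})" and one: "\<one>\<^bsub>value_group\<^esub> = value_class 1"
    by (simp_all add: value_group_def)
  have "comm_group value_group"
  proof (rule comm_groupI)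
    show "\<exists>Y\<in>carrier value_group. Y \<otimes>\<^bsub>value_group\<^esub> X = \<one>\<^bsub>value_group\<^esub>" if X: "X \<in> carrier value_group" for X
    proof -
      obtain x where "x \<noteq> 0" "X = value_class x" using X by (auto simp: C)
      then show ?thesis
        by (intro bexI[of _ "value_class (inverse x)"]) (auto simp: C one value_group_mult)
    qed
  qed (auto simp: C one value_group_mult mult_ac)
  moreover have "linear_order_on (carrier value_group) (ord_rel value_group)"
    unfolding linear_order_on_def partial_order_on_def preorder_on_def
  proof (intro conjI)
    show sub: "ord_rel value_group \<subseteq> carrier value_group \<times> carrier value_group"
      by (auto simp: value_group_def)
    show "refl_on (carrier value_group) (ord_rel value_group)"
    proof (rule refl_onI)
      show "(X, X) \<in> ord_rel value_group" if X: "X \<in> carrier value_group" for X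
      proof -
        obtain x where "x \<noteq> 0" "X = value_class x" using X by (auto simp: C)
        then show ?thesis by (simp add: value_group_ord_rel divs_refl)
      qed
    qed
    show "trans (ord_rel value_group)"
    proof (rule transI)
      fix X Y Z assume *: "(X, Y) \<in> ord_rel value_group" "(Y, Z) \<in> ord_rel value_group"
      then obtain x y z where "x \<noteq> 0" "y \<noteq> 0" "z \<noteq> 0" "X = value_class x" "Y = value_class y" "Z = value_class z"
        using sub unfolding C by blast
      then show "(X, Z) \<in> ord_rel value_group" using * divs_trans by (auto simp: value_group_ord_rel)
    qed
    show "antisym (ord_rel value_group)"
    proof (rule antisymI)
      fix X Y assume *: "(X, Y) \<in> ord_rel value_group" "(Y, X) \<in> ord_rel value_group"
      then obtain x y where "x \<noteq> 0" "y \<noteq> 0" "X = value_class x" "Y = value_class y"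
        using sub unfolding C by blast
      then show "X = Y" using * by (auto simp: value_group_ord_rel value_class_eq_iff)
    qed
    show "total_on (carrier value_group) (ord_rel value_group)"
    proof (rule total_onI)
      fix X Y assume "X \<in> carrier value_group" "Y \<in> carrier value_group"
      then obtain x y where "x \<noteq> 0" "y \<noteq> 0" "X = value_class x" "Y = value_class y" by (auto simp: C)
      then show "(X, Y) \<in> ord_rel value_group \<or> (Y, X) \<in> ord_rel value_group"
        using divs_total[of x y] by (simp add: value_group_ord_rel)
    qed
  qed
  moreover have "(a \<otimes>\<^bsub>value_group\<^esub> c, b \<otimes>\<^bsub>value_group\<^esub> c) \<in> ord_rel value_group"
    if ab: "(a, b) \<in> ord_rel value_group" and c: "c \<in> carrier value_group" for a b c
  proof -
    obtain x y z where "a = value_class x" "b = value_class y" "c = value_class z"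
      "x \<noteq> 0" "y \<noteq> 0" "z \<noteq> 0" "divs x y"
      using ab c by (auto simp: value_group_def)
    then show ?thesis by (simp add: value_group_mult value_group_ord_rel divs_mult divs_refl)
  qed
  ultimately show ?thesis
    by (simp add: ordered_abelian_group_def ordered_abelian_group_axioms_def)
qed

lemma val_le_valuation: "val_le value_group (valuation x) (valuation y) \<longleftrightarrow> y = 0 \<or> x \<noteq> 0 \<and> divs x y"
  by (auto simp: val_le_def valuation_def value_group_ord_rel)

lemma krull_valuation_valuation: "krull_valuation value_group valuation"
  unfolding krull_valuation_def
proof (intro conjI allI ordered_abelian_group_value_group)
  show "if x = 0 then valuation x = None else valuation x \<in> Some ` carrier value_group" for x
    by (simp add: valuation_def value_group_def)
  show "valuation (x * y) = val_add value_group (valuation x) (valuation y)" for x y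
    by (simp add: valuation_def value_group_mult)
  show "val_le value_group (valuation x) (valuation (x + y)) \<or> val_le value_group (valuation y) (valuation (x + y))"
    for x y
  proof (cases "x = 0 \<or> y = 0")
    case True
    then show ?thesis by (auto simp: val_le_valuation divs_refl)
  next
    case False
    then show ?thesis
      \<comment> \<open>If \<open>x\<close> divides \<open>y\<close>, then
        \<open>(x + y) / x = 1 + y / x\<close> lies in \<open>A\<close>; otherwise the roles are
        exchanged.\<close>
      using divs_total[of x y] add_mem[OF one_mem, of "y / x"] add_mem[OF one_mem, of "x / y"]
      by (auto simp: val_le_valuation divs_def add_divide_distrib add.commute)
  qed
qed

lemma valuation_ring_valuation: "valuation_ring value_group valuation = A"
proof -
  have "valuation 1 = Some \<one>\<^bsub>value_group\<^esub>" by (simp add: valuation_def value_group_def)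
  then show ?thesis
    using val_le_valuation[of 1] zero_mem unfolding valuation_ring_def by (auto simp: divs_def)
qed

lemma valuation_ideal_valuation: "valuation_ideal value_group valuation = {x \<in> A. x = 0 \<or> inverse x \<notin> A}"
proof -
  have "valuation x = Some \<one>\<^bsub>value_group\<^esub> \<longleftrightarrow> x \<noteq> 0 \<and> x \<in> A \<and> inverse x \<in> A" for x
    using value_class_eq_iff[of x 1]
    by (auto simp: valuation_def value_group_def divs_def inverse_eq_divide)
  then show ?thesis
    unfolding valuation_ideal_def valuation_ring_valuation by auto
qed

text \<open>One of \<open>x / y\<close> and \<open>y / x\<close> lies in \<open>A\<close>; if
  \<open>x - y\<close> had its inverse in \<open>A\<close>, then so would \<open>y\<close> or
  \<open>x\<close>, respectively.\<close>

lemma nonunit_diff: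
  assumes "x \<in> A" "x = 0 \<or> inverse x \<notin> A" "y \<in> A" "y = 0 \<or> inverse y \<notin> A"
  shows "x - y = 0 \<or> inverse (x - y) \<notin> A"
proof (rule ccontr)
  assume "\<not> ?thesis"
  then have d: "x - y \<noteq> 0" "inverse (x - y) \<in> A" by auto
  show False
  proof (cases "x = 0 \<or> y = 0")
    case True
    then show False
      using d assms uminus_mem[of "inverse (- y)"] by auto
  next
    case False
    then have eqs: "((x / y) - 1) * inverse (x - y) = inverse y" "(1 - (y / x)) * inverse (x - y) = inverse x"
      using d(1) by (simp_all add: field_simps)
    consider "x / y \<in> A" | "y / x \<in> A" using mem_or_inverse[of "x / y"] by auto
    then show False
    proof cases
      case 1
      then have "inverse y \<in> A" using mult_mem[OF diff_mem[OF _ one_mem] d(2)] eqs(1) by metis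
      then show False using assms False by blast
    next
      case 2
      then have "inverse x \<in> A" using mult_mem[OF diff_mem[OF one_mem] d(2)] eqs(2) by metis
      then show False using assms False by blast
    qed
  qed
qed

lemma residue_nonunit:
  assumes "a \<in> valuation_ideal value_group valuation"
  shows "residue value_group valuation a = residue value_group valuation 0"
proof -
  define I where "I = valuation_ideal value_group valuation"
  have diff: "x - y \<in> I" if "x \<in> I" "y \<in> I" for x y
    using that nonunit_diff[of x y] diff_mem[of x y] unfolding I_def valuation_ideal_valuation by auto
  have "0 \<in> I" unfolding I_def valuation_ideal_valuation using zero_mem by simp
  have a: "a \<in> I" using assms by (simp add: I_def)
  have res: "residue value_group valuation b = (\<lambda>h. h + b) ` I" for b
    unfolding residue_def I_def a_r_coset_def r_coset_def valuation_ring_struct_def by auto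
  have "(\<lambda>h. h + a) ` I = I"
  proof
    show "(\<lambda>h. h + a) ` I \<subseteq> I"
      using diff[OF _ diff[OF \<open>0 \<in> I\<close> a]] by auto
    show "I \<subseteq> (\<lambda>h. h + a) ` I"
    proof
      fix x assume "x \<in> I"
      then show "x \<in> (\<lambda>h. h + a) ` I" using diff[OF _ a] by (intro image_eqI[of _ _ "x - a"]) auto
    qed
  qed
  then show ?thesis by (simp add: res)
qed

text \<open>Nonunits have residue zero, which is nonnegative in any case, so only the signs of units
  matter.\<close>

lemma induced_ordering_subset:
  assumes "refl s" and "\<And>u. u \<in> A \<Longrightarrow> inverse u \<in> A \<Longrightarrow> u \<noteq> 0 \<Longrightarrow> (0, u) \<in> r \<Longrightarrow> (0, u) \<in> s"
  shows "induced_ordering value_group valuation r \<subseteq> induced_ordering value_group valuation s"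
proof -
  have "residue value_group valuation a \<in> residue value_group valuation ` {a \<in> A. (0, a) \<in> s}"
    if a: "a \<in> A" "(0, a) \<in> r" for a
  proof (cases "a = 0 \<or> inverse a \<notin> A")
    case True
    then have "residue value_group valuation a = residue value_group valuation 0"
      using a by (intro residue_nonunit) (simp add: valuation_ideal_valuation)
    then show ?thesis
      using zero_mem assms(1) by (auto intro!: image_eqI[of _ _ 0] dest: refl_onD)
  next
    case False
    then show ?thesis using assms(2) a by blast
  qed
  then show ?thesis
    unfolding induced_ordering_def valuation_ring_valuation by auto
qed

end

lemma valuation_subringI:
  assumes "ordered_field_rel r" "convex_subring r A"
  shows "valuation_subring A"
proof
  show "x \<in> A \<or> inverse x \<in> A" for x
    by (rule ordered_field_rel.convex_subring_or_inverse[OF assms])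
qed (use assms(2) in \<open>auto simp: convex_subring_def\<close>)

lemma (in valuation_subring) ex_unit_if_induced_orderings_distinct:
  assumes "ordered_field_rel r" "ordered_field_rel s"
    and "induced_ordering value_group valuation r \<noteq> induced_ordering value_group valuation s"
  shows "\<exists>u\<in>A. inverse u \<in> A \<and> 0 \<prec>\<^bsub>r\<^esub> u \<and> u \<prec>\<^bsub>s\<^esub> 0"
proof (rule ccontr)
  assume no: "\<not> ?thesis"
  interpret R: ordered_field_rel r by fact
  interpret S: ordered_field_rel s by fact
  have "(0, u) \<in> s" if u: "u \<in> A" "inverse u \<in> A" "u \<noteq> 0" "(0, u) \<in> r" for u
  proof (rule ccontr)
    assume "(0, u) \<notin> s"
    then have "u \<prec>\<^bsub>s\<^esub> 0" using S.not_le[of 0 u] by (simp only: ord_le_def simp_thms)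
    moreover have "0 \<prec>\<^bsub>r\<^esub> u" using u by (simp add: ord_less_def)
    ultimately show False using no u by blast
  qed
  \<comment> \<open>Here the signs are reversed, so \<open>- u\<close> is the excluded unit.\<close>
  moreover have "(0, u) \<in> r" if u: "u \<in> A" "inverse u \<in> A" "u \<noteq> 0" "(0, u) \<in> s" for u
  proof (rule ccontr)
    assume "(0, u) \<notin> r"
    then have "u \<prec>\<^bsub>r\<^esub> 0" using R.not_le[of 0 u] by (simp only: ord_le_def simp_thms)
    then have "0 \<prec>\<^bsub>r\<^esub> - u" by (simp only: R.neg_0_less_iff_less)
    moreover have "0 \<prec>\<^bsub>s\<^esub> u" using u by (simp add: ord_less_def)
    then have "- u \<prec>\<^bsub>s\<^esub> 0" by (simp only: S.neg_less_0_iff_less)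
    moreover have "- u \<in> A" "inverse (- u) \<in> A" using u uminus_mem by auto
    ultimately show False using no by blast
  qed
  moreover have "refl r" "refl s"
    using R.order_refl S.order_refl by (auto simp: refl_on_def ord_le_def)
  ultimately show False
    using induced_ordering_subset[of s r] induced_ordering_subset[of r s] assms(3) by blast
qed

section \<open>Weighted averages\<close>

context ordered_field_rel
begin

lemma summand_le_sum:
  assumes "finite K" "k \<in> K" "\<And>i. i \<in> K \<Longrightarrow> 0 \<prec>\<^bsub>r\<^esub> g i"
  shows "g k \<preceq>\<^bsub>r\<^esub> sum g K"
proof -
  have "0 \<preceq>\<^bsub>r\<^esub> sum g (K - {k})" using assms(3) by (intro sum_nonneg less_imp_le) auto
  then show ?thesis unfolding sum.remove[OF assms(1,2)] by (rule add_increasing2) (rule order_refl)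
qed

text \<open>One summand above \<open>c\<close> already pushes the weight down to \<open>1/c\<close>.
  On \<open>S j\<close> this bounds the weights of the indices other than \<open>j\<close>.\<close>

lemma inverse_one_add_sum_mult_le:
  assumes "finite K" "k \<in> K" "\<And>i. i \<in> K \<Longrightarrow> 0 \<prec>\<^bsub>r\<^esub> g i" "c \<prec>\<^bsub>r\<^esub> g k"
  shows "inverse (1 + sum g K) * c \<preceq>\<^bsub>r\<^esub> 1"
proof -
  have "g k \<preceq>\<^bsub>r\<^esub> sum g K"
    using assms(1-3) by (rule summand_le_sum)
  then have "g k \<preceq>\<^bsub>r\<^esub> 1 + sum g K" by (rule add_increasing[OF zero_le_one])
  then have c: "c \<preceq>\<^bsub>r\<^esub> 1 + sum g K" by (rule order_trans[OF less_imp_le[OF assms(4)]])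
  have "0 \<preceq>\<^bsub>r\<^esub> sum g K" using assms(3) by (intro sum_nonneg less_imp_le)
  then have "0 \<prec>\<^bsub>r\<^esub> 1 + sum g K" by (rule add_pos_nonneg[OF zero_less_one])
  then show ?thesis using c by (simp only: inverse_eq_divide times_divide_eq_left mult_1 pos_divide_le_eq)
qed

text \<open>At most \<open>n\<close> summands, each below \<open>1/(n + 1)\<close>, add up to at
  most 1, so the weight is at least one half. On \<open>S j\<close> this is the weight of
  \<open>j\<close>.\<close>

lemma one_le_two_inverse_one_add_sum:
  assumes "card K \<le> n" "\<And>k. k \<in> K \<Longrightarrow> 0 \<prec>\<^bsub>r\<^esub> g k"
    "\<And>k. k \<in> K \<Longrightarrow> of_nat (Suc n) \<preceq>\<^bsub>r\<^esub> c k" "\<And>k. k \<in> K \<Longrightarrow> g k \<prec>\<^bsub>r\<^esub> inverse (c k)"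
  shows "1 \<preceq>\<^bsub>r\<^esub> 2 * inverse (1 + sum g K)"
proof -
  define M where "M = (of_nat (Suc n) :: 'a)"
  have M: "0 \<prec>\<^bsub>r\<^esub> M" unfolding M_def by (simp only: of_nat_0_less_iff zero_less_Suc)
  have "g k \<preceq>\<^bsub>r\<^esub> inverse M" if "k \<in> K" for k
    using le_imp_inverse_le[OF assms(3)[OF that, folded M_def] M]
    by (rule order_trans[OF less_imp_le[OF assms(4)[OF that]]])
  then have "sum g K \<preceq>\<^bsub>r\<^esub> (\<Sum>k\<in>K. inverse M)" by (rule sum_mono)
  also have "(\<Sum>k\<in>K. inverse M) = of_nat (card K) * inverse M" by (rule sum_constant)
  also have "of_nat (card K) \<preceq>\<^bsub>r\<^esub> M"
    unfolding M_def of_nat_le_iff using assms(1) by simp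
  then have "of_nat (card K) * inverse M \<preceq>\<^bsub>r\<^esub> M * inverse M"
    by (rule mult_right_mono) (rule less_imp_le[OF positive_imp_inverse_positive[OF M]])
  also have "M * inverse M = 1" using M by (intro right_inverse) auto
  finally have "1 + sum g K \<preceq>\<^bsub>r\<^esub> 1 + 1" by (rule add_left_mono)
  then have "1 + sum g K \<preceq>\<^bsub>r\<^esub> 2" by (simp only: one_add_one)
  moreover have "0 \<preceq>\<^bsub>r\<^esub> sum g K" using assms(2) by (intro sum_nonneg less_imp_le)
  then have "0 \<prec>\<^bsub>r\<^esub> 1 + sum g K" by (rule add_pos_nonneg[OF zero_less_one])
  ultimately show ?thesis
    by (simp only: inverse_eq_divide times_divide_eq_right mult_1_right pos_le_divide_eq mult_1_left)
qed

text \<open>Used for \<open>t\<close> and \<open>- t\<close>, this replaces an absolute value by an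
  expression that is the same for all orderings.\<close>

lemma le_one_add_square: "t \<preceq>\<^bsub>r\<^esub> 1 + t\<^sup>2"
proof (cases "t \<preceq>\<^bsub>r\<^esub> 1")
  case True
  then show ?thesis by (rule add_increasing2[OF zero_le_power2])
next
  case False
  then have t: "1 \<prec>\<^bsub>r\<^esub> t" by (simp only: not_le)
  have "t * 1 \<preceq>\<^bsub>r\<^esub> t * t"
    by (rule mult_left_mono[OF less_imp_le[OF t] less_imp_le[OF less_trans[OF zero_less_one t]]])
  then have "t \<preceq>\<^bsub>r\<^esub> t\<^sup>2" by (simp only: power2_eq_square mult_1_right)
  then show ?thesis by (rule add_increasing[OF zero_le_one])
qed

text \<open>Up to the factor \<open>z\<close> the error is \<open>q / D\<close>. Both
  \<open>q\<close> and \<open>- q\<close> are at most \<open>Q\<close>, and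
  \<open>M * Q < n + 1 <= M * h j <= M * D\<close> gives \<open>Q < D\<close>.\<close>

lemma weighted_average_close:
  assumes I: "finite I" "j \<in> I" "card I \<le> n" and h: "\<And>i. i \<in> I \<Longrightarrow> 0 \<prec>\<^bsub>r\<^esub> h i"
    and hj: "1 \<preceq>\<^bsub>r\<^esub> 2 * h j" and z: "z \<noteq> 0"
    and small: "\<And>i. i \<in> I \<Longrightarrow> i \<noteq> j \<Longrightarrow>
      h i * (2 * of_nat (Suc n) * (1 + ((x i - x j) / z)\<^sup>2)) \<preceq>\<^bsub>r\<^esub> 1"
  shows "((\<Sum>i\<in>I. h i * x i) / (\<Sum>i\<in>I. h i) - x j)\<^sup>2 \<prec>\<^bsub>r\<^esub> z\<^sup>2"
proof -
  define D where "D = sum h I"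
  define t where "t i = (x i - x j) / z" for i
  define q where "q = (\<Sum>i\<in>I. h i * t i)"
  define Q where "Q = (\<Sum>i\<in>I - {j}. h i * (1 + (t i)\<^sup>2))"
  define M where "M = (2 * of_nat (Suc n) :: 'a)"
  have M: "0 \<prec>\<^bsub>r\<^esub> M"
    unfolding M_def by (rule mult_pos_pos[OF zero_less_numeral]) (simp only: of_nat_0_less_iff zero_less_Suc)
  have "h j \<preceq>\<^bsub>r\<^esub> D" unfolding D_def using I(1,2) h by (rule summand_le_sum)
  have D: "0 \<prec>\<^bsub>r\<^esub> D" by (rule less_le_trans[OF h[OF I(2)] \<open>h j \<preceq>\<^bsub>r\<^esub> D\<close>])
  then have "D \<noteq> 0" by auto
  \<comment> \<open>The summand for \<open>j\<close> drops out because
    \<open>t j = 0\<close>.\<close>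
  have q_eq: "q = (\<Sum>i\<in>I - {j}. h i * t i)"
    unfolding q_def using I by (subst sum.remove[of I j]) (auto simp: t_def)
  have qQ: "q \<preceq>\<^bsub>r\<^esub> Q"
    unfolding q_eq Q_def using h by (intro sum_mono mult_left_mono le_one_add_square less_imp_le) auto
  have minus_t: "- t i \<preceq>\<^bsub>r\<^esub> 1 + (t i)\<^sup>2" for i using le_one_add_square[of "- t i"] by (simp only: power2_minus)
  have "(\<Sum>i\<in>I - {j}. h i * - t i) \<preceq>\<^bsub>r\<^esub> Q"
    unfolding Q_def using h by (intro sum_mono mult_left_mono minus_t less_imp_le) auto
  then have qQ': "- q \<preceq>\<^bsub>r\<^esub> Q" by (simp only: q_eq mult_minus_right sum_negf)
  have "M * Q = (\<Sum>i\<in>I - {j}. h i * (M * (1 + (t i)\<^sup>2)))"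
    unfolding Q_def sum_distrib_left by (simp only: mult.left_commute)
  also have "\<dots> \<preceq>\<^bsub>r\<^esub> (\<Sum>i\<in>I - {j}. 1)"
    unfolding M_def t_def using small by (intro sum_mono) blast
  also have "(\<Sum>i\<in>I - {j}. 1) = of_nat (card (I - {j})) * (1 :: 'a)" by (rule sum_constant)
  \<comment> \<open>Strictness enters here: at most \<open>n\<close> summands are compared with
    \<open>n + 1\<close>.\<close>
  also have "of_nat (card (I - {j})) * 1 \<prec>\<^bsub>r\<^esub> of_nat (Suc n)"
    unfolding mult_1_right of_nat_less_iff using I card_Diff1_le[of I j] by linarith
  also have "of_nat (Suc n) \<preceq>\<^bsub>r\<^esub> of_nat (Suc n) * (2 * h j)"
    using mult_left_mono[OF hj of_nat_0_le_iff[of "Suc n"]] by (simp only: mult_1_right)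
  also have "of_nat (Suc n) * (2 * h j) = M * h j" by (simp only: M_def mult_ac)
  also have "M * h j \<preceq>\<^bsub>r\<^esub> M * D" by (rule mult_left_mono[OF \<open>h j \<preceq>\<^bsub>r\<^esub> D\<close> less_imp_le[OF M]])
  finally have "Q \<prec>\<^bsub>r\<^esub> D" by (simp only: mult_less_cancel_left_pos[OF M])
  then have "q \<prec>\<^bsub>r\<^esub> D" "- q \<prec>\<^bsub>r\<^esub> D" by (rule le_less_trans[OF qQ], rule le_less_trans[OF qQ'])
  have "q\<^sup>2 \<prec>\<^bsub>r\<^esub> D\<^sup>2"
  proof (cases "0 \<preceq>\<^bsub>r\<^esub> q")
    case True
    show ?thesis by (rule power_strict_mono[OF \<open>q \<prec>\<^bsub>r\<^esub> D\<close> True]) simp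
  next
    case False
    then have "0 \<preceq>\<^bsub>r\<^esub> - q" by (simp only: not_le neg_0_le_iff_le less_imp_le)
    from power_strict_mono[OF \<open>- q \<prec>\<^bsub>r\<^esub> D\<close> this, of 2] show ?thesis by (simp only: power2_minus zero_less_numeral)
  qed
  moreover have "0 \<prec>\<^bsub>r\<^esub> (z / D)\<^sup>2" using z \<open>D \<noteq> 0\<close> by (simp only: zero_less_power2 divide_eq_0_iff simp_thms)
  ultimately have "(z / D)\<^sup>2 * q\<^sup>2 \<prec>\<^bsub>r\<^esub> (z / D)\<^sup>2 * D\<^sup>2" by (rule mult_strict_left_mono)
  moreover have "(z / D)\<^sup>2 * D\<^sup>2 = z\<^sup>2" using \<open>D \<noteq> 0\<close> by (simp add: power_divide)
  moreover have "z * (h i * t i) = h i * x i - x j * h i" for i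
  proof -
    have "z * t i = x i - x j" using z by (simp add: t_def)
    then show ?thesis by (simp only: mult.left_commute[of z] right_diff_distrib mult.commute[of "x j"])
  qed
  then have "z * q = (\<Sum>i\<in>I. h i * x i) - x j * D"
    unfolding q_def D_def sum_distrib_left by (simp only: sum_subtractf)
  then have "(\<Sum>i\<in>I. h i * x i) / D - x j = z / D * q"
    using \<open>D \<noteq> 0\<close> by (simp add: field_simps)
  ultimately show ?thesis unfolding D_def[symmetric] by (simp only: power_mult_distrib)
qed

end

text \<open>The thresholds \<open>c i j\<close> of the final proof have this form. The first bound
  controls the dominant weight, the second is required by the compactness argument.\<close>

lemma (in ordered_field_rel) of_nat_mult_one_add_square_bounds:
  shows "of_nat (Suc n) \<preceq>\<^bsub>r\<^esub> 2 * of_nat (Suc n) * (1 + t\<^sup>2)" "2 \<preceq>\<^bsub>r\<^esub> 2 * of_nat (Suc n) * (1 + t\<^sup>2)"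
proof -
  have n: "1 \<preceq>\<^bsub>r\<^esub> of_nat (Suc n)" using of_nat_le_iff[of 1 "Suc n"] by simp
  have n0: "0 \<preceq>\<^bsub>r\<^esub> of_nat (Suc n)" by (rule of_nat_0_le_iff)
  have t: "1 \<preceq>\<^bsub>r\<^esub> 1 + t\<^sup>2" by (rule add_increasing2[OF zero_le_power2 order_refl])
  have "2 * 1 \<preceq>\<^bsub>r\<^esub> 2 * of_nat (Suc n)" by (rule mult_left_mono[OF n zero_le_numeral])
  moreover have *: "2 * of_nat (Suc n) * 1 \<preceq>\<^bsub>r\<^esub> 2 * of_nat (Suc n) * (1 + t\<^sup>2)"
    by (rule mult_left_mono[OF t mult_nonneg_nonneg[OF zero_le_numeral n0]])
  ultimately show "2 \<preceq>\<^bsub>r\<^esub> 2 * of_nat (Suc n) * (1 + t\<^sup>2)"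
    unfolding mult_1_right by (rule order_trans)
  have "of_nat (Suc n) \<preceq>\<^bsub>r\<^esub> 2 * of_nat (Suc n)"
    unfolding mult_2 by (rule add_increasing[OF n0 order_refl])
  then show "of_nat (Suc n) \<preceq>\<^bsub>r\<^esub> 2 * of_nat (Suc n) * (1 + t\<^sup>2)"
    by (rule order_trans[OF _ *[unfolded mult_1_right]])
qed

section \<open>Construction of the approximating element\<close>

theorem theorem1p8:
  fixes n :: nat and x z :: "nat \<Rightarrow> 'a::field" and S :: "nat \<Rightarrow> 'a rel set"
  assumes z_nonzero: "\<And>i. i \<in> {1..n} \<Longrightarrow> z i \<noteq> 0"
    and S_orderings: "\<And>i. i \<in> {1..n} \<Longrightarrow> S i \<subseteq> field_orderings"
    and S_disjoint: "disjoint_family_on S {1..n}"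
    and T: "\<And>i. i \<in> {1..n} \<Longrightarrow> compactin harrison_topology (S i)"
    and I: "\<And>(G :: 'a set ordered_group) w i j r s.
      \<lbrakk>krull_valuation G w; i \<in> {1..n}; j \<in> {1..n}; i \<noteq> j; r \<in> S i; s \<in> S j;
        convex_wrt r (valuation_ring G w); convex_wrt s (valuation_ring G w)\<rbrakk> \<Longrightarrow>
      induced_ordering G w r \<noteq> induced_ordering G w s \<and>
      val_le G (w (z i)) (w (x i - x j)) \<and> w (z i) = w (z j)"
  shows "\<exists>y::'a. \<forall>i\<in>{1..n}. \<forall>r\<in>S i.
    ((y - x i)\<^sup>2, (z i)\<^sup>2) \<in> r \<and> (y - x i)\<^sup>2 \<noteq> (z i)\<^sup>2"
proof -
  define t where "t i j = (x i - x j) / z j" for i j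
  \<comment> \<open>This is the factor in the smallness condition of
    \<open>weighted_average_close\<close>; as a field element it is the same for all
    orderings.\<close>
  define c where "c i j = 2 * of_nat (Suc n) * (1 + (t i j)\<^sup>2)" for i j
  have ord: "ordered_field_rel r" if "i \<in> {1..n}" "r \<in> S i" for i r
    using S_orderings that by (blast intro: ordered_field_relI)
  have c: "of_nat (Suc n) \<preceq>\<^bsub>r\<^esub> c i j" "2 \<preceq>\<^bsub>r\<^esub> c i j" if "r \<in> field_orderings" for r i j
    unfolding c_def
    using ordered_field_rel.of_nat_mult_one_add_square_bounds[OF ordered_field_relI[OF that]] by blast+
  have c1: "1 \<preceq>\<^bsub>r\<^esub> c i j" if r: "r \<in> field_orderings" for r i j
  proof -
    interpret ordered_field_rel r by (rule ordered_field_relI[OF r])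
    show ?thesis by (rule order_trans[OF _ c(2)[OF r]]) simp
  qed
  have sep: "\<exists>h. h \<noteq> 0 \<and> c i j \<prec>\<^bsub>r\<^esub> h\<^sup>2 \<and> c i j \<prec>\<^bsub>s\<^esub> inverse (h\<^sup>2)"
    if ij: "i \<in> {1..n}" "j \<in> {1..n}" "i \<noteq> j" and r: "r \<in> S j" and s: "s \<in> S i" for i j r s
  proof (rule ex_square_separating)
    show "ordered_field_rel r" "ordered_field_rel s" using ord ij r s by blast+
    show "1 \<preceq>\<^bsub>r\<^esub> c i j" "1 \<preceq>\<^bsub>s\<^esub> c i j" using c1 S_orderings ij r s by blast+
    fix A assume A: "convex_subring r A" "convex_subring s A"
    interpret valuation_subring A by (rule valuation_subringI[OF ord[OF ij(2) r] A(1)])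
    have "convex_wrt r A" "convex_wrt s A" using A by (simp_all add: convex_subring_def)
    \<comment> \<open>(I) is applied to the valuation with ring \<open>A\<close>, with
      \<open>j\<close> in first place because \<open>r\<close> belongs to \<open>S j\<close>; the
      value of \<open>z j\<close> then makes the difference divisible by \<open>z j\<close>.\<close>
    with I[OF krull_valuation_valuation ij(2,1) _ r s] ij(3)
    have *: "induced_ordering value_group valuation r \<noteq> induced_ordering value_group valuation s"
      "val_le value_group (valuation (z j)) (valuation (x j - x i))"
      by (auto simp: valuation_ring_valuation)
    from *(2) have "(x j - x i) / z j \<in> A"
      using zero_mem by (auto simp: val_le_valuation divs_def)
    then have "t i j \<in> A"
      using uminus_mem unfolding t_def by (metis minus_diff_eq minus_divide_left)
    moreover have "2 * of_nat (Suc n) \<in> A"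
      using convex_subring_of_nat[OF A(1), of "2 * Suc n"] by (simp only: of_nat_mult of_nat_numeral)
    ultimately have "c i j \<in> A"
      unfolding c_def power2_eq_square by (blast intro: mult_mem[OF _ add_mem[OF one_mem mult_mem]])
    then show "c i j \<in> A \<and> (\<exists>u\<in>A. inverse u \<in> A \<and> 0 \<prec>\<^bsub>r\<^esub> u \<and> u \<prec>\<^bsub>s\<^esub> 0)"
      using ex_unit_if_induced_orderings_distinct[OF ord[OF ij(2) r] ord[OF ij(1) s] *(1)] by blast
  qed
  have "\<exists>h. totally_positive h \<and> (\<forall>r\<in>S j. c i j \<prec>\<^bsub>r\<^esub> h) \<and> (\<forall>s\<in>S i. h \<prec>\<^bsub>s\<^esub> inverse (c i j))"
    if "i \<in> {1..n}" "j \<in> {1..n}" "i \<noteq> j" for i j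
    using that by (intro compact_separation c S_orderings T sep)
  then obtain g where g: "\<And>i j. i \<in> {1..n} \<Longrightarrow> j \<in> {1..n} \<Longrightarrow> i \<noteq> j \<Longrightarrow>
    totally_positive (g i j) \<and> (\<forall>r\<in>S j. c i j \<prec>\<^bsub>r\<^esub> g i j) \<and> (\<forall>s\<in>S i. g i j \<prec>\<^bsub>s\<^esub> inverse (c i j))"
    by metis
  \<comment> \<open>Since \<open>g i j\<close> is large on \<open>S j\<close> and small on
    \<open>S i\<close>, on \<open>S j\<close> each \<open>h i\<close> with \<open>i\<close>
    different from \<open>j\<close> is small because of its summand \<open>g i j\<close>, whereas
    all summands in \<open>h j\<close> are small.\<close>
  define h where "h i = inverse (1 + sum (g i) ({1..n} - {i}))" for i
  show ?thesis
  proof (intro exI[of _ "(\<Sum>i\<in>{1..n}. h i * x i) / (\<Sum>i\<in>{1..n}. h i)"] ballI conjI)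
    fix j r assume j: "j \<in> {1..n}" and r: "r \<in> S j"
    interpret ordered_field_rel r by (rule ord[OF j r])
    have rf: "r \<in> field_orderings" using S_orderings j r by blast
    have g0: "0 \<prec>\<^bsub>r\<^esub> g i k" if "i \<in> {1..n}" "k \<in> {1..n} - {i}" for i k
      using g[of i k] that rf by (auto simp: totally_positive_def)
    have "((\<Sum>i\<in>{1..n}. h i * x i) / (\<Sum>i\<in>{1..n}. h i) - x j)\<^sup>2 \<prec>\<^bsub>r\<^esub> (z j)\<^sup>2"
    proof (rule weighted_average_close[OF _ j])
      show "0 \<prec>\<^bsub>r\<^esub> h i" if i: "i \<in> {1..n}" for i
        unfolding h_def
        by (intro positive_imp_inverse_positive add_pos_nonneg[OF zero_less_one] sum_nonneg less_imp_le[OF g0[OF i]])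
      have "card ({1..n} - {j}) \<le> n" using card_Diff1_le[of "{1..n}" j] by simp
      then show "1 \<preceq>\<^bsub>r\<^esub> 2 * h j"
        unfolding h_def
      proof (rule one_le_two_inverse_one_add_sum)
        show "g j k \<prec>\<^bsub>r\<^esub> inverse (c j k)" if "k \<in> {1..n} - {j}" for k using g[of j k] that j r by blast
      qed (rule g0[OF j] c(1)[OF rf]; assumption?)+
      show "h i * (2 * of_nat (Suc n) * (1 + ((x i - x j) / z j)\<^sup>2)) \<preceq>\<^bsub>r\<^esub> 1"
        if i: "i \<in> {1..n}" "i \<noteq> j" for i
        unfolding h_def t_def[symmetric] c_def[symmetric]
      proof (rule inverse_one_add_sum_mult_le)
        show "c i j \<prec>\<^bsub>r\<^esub> g i j" using g[OF i(1) j i(2)] r by blast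
      qed (use i j g0[OF i(1)] in auto)
    qed (use z_nonzero[OF j] in simp_all)
    then show "((\<Sum>i\<in>{1..n}. h i * x i) / (\<Sum>i\<in>{1..n}. h i) - x j)\<^sup>2 \<noteq> (z j)\<^sup>2"
      and "(((\<Sum>i\<in>{1..n}. h i * x i) / (\<Sum>i\<in>{1..n}. h i) - x j)\<^sup>2, (z j)\<^sup>2) \<in> r"
      unfolding ord_less_def by blast+
  qed
qed

end
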